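(* Let $\xi$ be a random variable with symmetric distribution whose tail function satisfies $T(x)=T_\xi(x)=x^{-2}\log^{\gamma}(x)\,L(\log x)$ for $x>e$, where $\gamma\in\mathbb{R}$ is a constant and $L$ is a positive continuous function slowly varying at $\infty$. With $U$ the uniform tail function defined in the context: A. If $\gamma\ge-1$, then there is a constant $C=C(\gamma,L)\in(0,\infty)$ such that $$U(x)\le C\,x^{-2}[\log x]^{\gamma+1}L(\log x)=C\,T(x)\log x,\qquad x>e.$$ B. If $\gamma<-1$, then there is a constant $C=C(L)\in(0,\infty)$ such that $$U(x)\le C\,x^{-2},\qquad x>1.$$
   Context: For a random variable $\eta$ the tail function is $T_\eta(x)=\mathbf{P}(|\eta|\ge x)$, $x>0$. For the symmetric random variable $\xi$ put $\psi(t)=\psi_\xi(t)=1-\mathbf{E}e^{it\xi}=\mathbf{E}(1-\cos(t\xi))$. Let $\xi(k)$, $k=1,2,\dots$, be independent copies of $\xi$. The natural norming sequence $b(n)$ is defined by $b(1)=1$ and, for $n=2,3,\dots$, $b(n)$ is a positive solution of $n\,\psi(1/b(n))=1$ (for all sufficiently large $n$ the solution exists and is unique, and $b(n)\to\infty$). Set $S(n)=b(n)^{-1}\sum_{k=1}^n\xi(k)$ and $U(x)=\sup_{n\ge1}T_{S(n)}(x)$.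
   Formalization: The constants C may depend on the whole law of ξ and on the chosen norming sequence b(n), not only on γ and L; dependence on (γ,L) alone is false, e.g. when the mass inside [-e,e] sits at ±δ with δ→0. *)

theory Defs
  imports "HOL-Probability.Probability"
begin

definition tail_fun :: "'a measure \<Rightarrow> ('a \<Rightarrow> real) \<Rightarrow> real \<Rightarrow> real" where
  "tail_fun M \<eta> x = measure M {\<omega> \<in> space M. \<bar>\<eta> \<omega>\<bar> \<ge> x}"

definition symmetric_rv :: "'a measure \<Rightarrow> ('a \<Rightarrow> real) \<Rightarrow> bool" where
  "symmetric_rv M \<xi> \<longleftrightarrow> distr M borel \<xi> = distr M borel (\<lambda>\<omega>. - \<xi> \<omega>)"

definition slowly_varying :: "(real \<Rightarrow> real) \<Rightarrow> bool" where
  "slowly_varying L \<longleftrightarrow> (\<forall>c>0. ((\<lambda>y. L (c * y) / L y) \<longlongrightarrow> 1) at_top)"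

(* For symmetric \<xi> this is 1 - char (distr M borel \<xi>) t, which is then real. *)
definition psi :: "'a measure \<Rightarrow> ('a \<Rightarrow> real) \<Rightarrow> real \<Rightarrow> real" where
  "psi M \<xi> t = (\<integral>\<omega>. 1 - cos (t * \<xi> \<omega>) \<partial>M)"

(* The equation n * psi (1 / s) = 1 may have no solution for finitely many small n (for
   instance if \<xi> has a large atom at 0); there b n is an arbitrary positive number.
   Where there are several solutions, b n is any of them. The divergence of b is part of
   the notion: it selects, for large n, the solution with 1 / b n near 0. If the solution
   is unique for all large n, divergence is automatic; without it, a law with
   liminf of psi equal to 0 at infinity would admit small solutions for every n. *)
definition natural_norming :: "'a measure \<Rightarrow> ('a \<Rightarrow> real) \<Rightarrow> (nat \<Rightarrow> real) \<Rightarrow> bool" where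
  "natural_norming M \<xi> b \<longleftrightarrow>
     b 1 = 1 \<and>
     (\<forall>n\<ge>1. b n > 0) \<and>
     (\<forall>n\<ge>2. (\<exists>s>0. real n * psi M \<xi> (1 / s) = 1) \<longrightarrow> real n * psi M \<xi> (1 / b n) = 1) \<and>
     filterlim b at_top sequentially"

definition independent_copies ::
    "'a measure \<Rightarrow> ('a \<Rightarrow> real) \<Rightarrow> (nat \<Rightarrow> 'a \<Rightarrow> real) \<Rightarrow> bool" where
  "independent_copies M \<xi> X \<longleftrightarrow>
     prob_space.indep_vars M (\<lambda>_. borel) X {1..} \<and>
     (\<forall>k\<ge>1. distr M borel (X k) = distr M borel \<xi>)"

definition normed_sum :: "(nat \<Rightarrow> 'a \<Rightarrow> real) \<Rightarrow> (nat \<Rightarrow> real) \<Rightarrow> nat \<Rightarrow> 'a \<Rightarrow> real" where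
  "normed_sum X b n \<omega> = (\<Sum>k=1..n. X k \<omega>) / b n"

definition uniform_tail ::
    "'a measure \<Rightarrow> (nat \<Rightarrow> 'a \<Rightarrow> real) \<Rightarrow> (nat \<Rightarrow> real) \<Rightarrow> real \<Rightarrow> real" where
  "uniform_tail M X b x = (SUP n\<in>{1..}. tail_fun M (normed_sum X b n) x)"

end

theory Submission
  imports Defs
begin

text \<open>
  Write \<open>T\<close> for the tail of \<open>\<xi>\<close>, \<open>G w = w powr \<gamma> * L w\<close>, so that \<open>T x = G (ln x) / x ^ 2\<close> for \<open>x > exp 1\<close>,
  and \<open>K2 y\<close> for the mean of \<open>min \<bar>\<xi>\<bar> y ^ 2\<close>.  A large value of a sum of \<open>n\<close> independent copies is either
  the work of one copy or of many.  Cutting every summand off at the level \<open>z = x * b n\<close> separates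
  the two: one copy reaching \<open>z\<close> costs \<open>n * T z\<close>, and the sum of the bounded, centred remainders is
  controlled by Markov's inequality with second or fourth moments (\<open>tail_sum_le_second_moment\<close>,
  \<open>tail_sum_le_fourth_moment\<close>).

  The norming equation enters only through \<open>n * K2 (b n) \<le> 8 * b n ^ 2\<close> for large \<open>n\<close>
  (\<open>natural_norming_eventually\<close>): near 0, \<open>psi t\<close> is at least a multiple of \<open>t ^ 2 * K2 (1 / t)\<close>, because
  the part of \<open>K2\<close> that comes from \<open>\<bar>\<xi>\<bar> \<ge> 1 / t\<close> is negligible for this tail.  The remaining,
  finitely many \<open>n\<close> are handled one by one.

  If \<open>\<gamma> < -1\<close>, then \<open>K2\<close> is bounded and second moments give the bound \<open>C / x ^ 2\<close>.

  If \<open>\<gamma> \<ge> -1\<close>, set \<open>u = ln x\<close> and \<open>l = ln (b n)\<close>.  The single-copy term is at most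
  \<open>8 * G (u + l) / (K2 (b n) * x ^ 2)\<close>, and it has to be compared with \<open>T x * ln x = u * G u / x ^ 2\<close>.
  This is the estimate \<open>G_product_bound\<close>; it distinguishes which of \<open>u\<close> and \<open>l\<close> is larger, and uses that
  \<open>K2 (exp l)\<close> is at least of the order \<open>l * G l\<close> (\<open>G_le_second_moment\<close>).  Second moments alone
  would not do when \<open>\<gamma> = -1\<close>, since then \<open>K2\<close> can grow while \<open>u * G u = L u\<close> tends to 0.  With
  fourth moments the contribution of many copies is negligible.

  Throughout, \<open>G\<close> is compared at different points by Potter's bounds for the slowly varying \<open>L\<close>,
  which rest on Baire's theorem (\<open>eventually_uniform_increment_bound\<close>).
\<close>

section \<open>Potter bounds for slowly varying functions\<close>

text \<open>
  The Baire argument behind the uniform convergence theorem, for \<open>h t = ln (L (exp t))\<close>.  The closed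
  sets of those shifts \<open>s\<close> for which \<open>\<bar>h (t + s) - h t\<bar> \<le> 1\<close> from time \<open>k + 1\<close> on exhaust the unit
  interval, so one of them contains an interval.  Differences of its points give all
  sufficiently small shifts, and finitely many small shifts make up a shift of length at most 1.
\<close>

lemma eventually_uniform_increment_bound:
  fixes h :: "real \<Rightarrow> real"
  assumes cont: "continuous_on {0<..} h"
    and lim: "\<And>s. ((\<lambda>t. h (t + s) - h t) \<longlongrightarrow> 0) at_top"
  obtains R C where "R > 0" "C \<ge> 0"
    "\<And>t s. t \<ge> R \<Longrightarrow> 0 \<le> s \<Longrightarrow> s \<le> 1 \<Longrightarrow> \<bar>h (t + s) - h t\<bar> \<le> C"
proof -
  define F where "F = (\<lambda>k::nat. {s\<in>{0..1::real}. \<forall>t\<ge>real k + 1. \<bar>h (t + s) - h t\<bar> \<le> 1})"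
  have F_closed: "closed (F k)" for k
  proof -
    have "F k = {0..1} \<inter> (\<Inter>t\<in>{real k + 1..}. {s\<in>{0..1}. \<bar>h (t + s) - h t\<bar> \<le> 1})"
      by (auto simp: F_def)
    moreover have "closed {s\<in>{0..1}. \<bar>h (t + s) - h t\<bar> \<le> 1}" if "t \<ge> real k + 1" for t
    proof -
      have "continuous_on {0..1} (\<lambda>s. h (t + s))"
        using that by (intro continuous_on_compose2[OF cont]) (auto intro!: continuous_intros)
      then show ?thesis
        by (intro continuous_closed_preimage_constant continuous_on_closed_Collect_le
              continuous_intros) auto
    qed
    ultimately show ?thesis by (auto intro!: closed_Int closed_INT)
  qed
  have F_cover: "{0..1} \<subseteq> (\<Union>k. F k)"
  proof
    fix s :: real assume s: "s \<in> {0..1}"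
    have "\<forall>\<^sub>F t in at_top. \<bar>h (t + s) - h t\<bar> < 1"
      using tendstoD[OF lim[of s], of 1] by (simp add: dist_real_def)
    then obtain N where N: "\<And>t. t \<ge> N \<Longrightarrow> \<bar>h (t + s) - h t\<bar> < 1"
      by (auto simp: eventually_at_top_linorder)
    obtain k where "real k \<ge> N" using real_arch_simple by blast
    then have "s \<in> F k" using s N by (force simp: F_def intro: less_imp_le)
    then show "s \<in> (\<Union>k. F k)" by blast
  qed
  have "\<exists>k. \<not> {0..1} \<subseteq> closure ({0..1} - F k)"
  proof (rule ccontr)
    assume dense: "\<nexists>k. \<not> {0..1} \<subseteq> closure ({0..1} - F k)"
    have "{0..1::real} \<subseteq> closure (\<Inter> (range (\<lambda>k. {0..1} - F k)))"
    proof (rule Baire)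
      fix T assume "T \<in> range (\<lambda>k. {0..1} - F k)"
      then obtain k where T: "T = {0..1} - F k" by auto
      have "openin (top_of_set {0..1}) T"
        unfolding T using F_closed[of k] by (metis Diff_eq closed_def openin_open_Int)
      with dense T show "openin (top_of_set {0..1}) T \<and> {0..1} \<subseteq> closure T" by auto
    qed auto
    moreover have "\<Inter> (range (\<lambda>k. {0..1} - F k)) = {}" using F_cover by auto
    ultimately have "{0..1::real} \<subseteq> closure {}" by (simp only:)
    then show False by simp
  qed
  then obtain k s0 where s0: "s0 \<in> {0..1}" "s0 \<notin> closure ({0..1} - F k)" unfolding subset_iff by blast
  then obtain e where "e > 0" "\<forall>s\<in>{0..1} - F k. \<not> dist s s0 < e"
    unfolding closure_approachable by blast
  then have e: "e > 0" "\<And>s. s \<in> {0..1} \<Longrightarrow> \<bar>s - s0\<bar> < e \<Longrightarrow> s \<in> F k"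
    unfolding dist_real_def by blast+
  define a where "a = max 0 (s0 - e/2)"
  define d where "d = min 1 (s0 + e/2) - a"
  have d: "d > 0" using s0 e(1) by (auto simp: a_def d_def)
  have inF: "s \<in> F k" if "a \<le> s" "s \<le> a + d" for s
    using that s0 e(1) by (intro e(2)) (auto simp: a_def d_def)
  define R where "R = real k + 2"
  have small: "\<bar>h (t + s) - h t\<bar> \<le> 2" if "t \<ge> R" "0 \<le> s" "s \<le> d" for t s
  proof -
    have a: "0 \<le> a" "a \<le> 1" using s0 e by (auto simp: a_def)
    have "a + s \<in> F k" "a \<in> F k" using inF that d by auto
    moreover have "real k + 1 \<le> t - a" using that a by (simp add: R_def)
    ultimately have "\<bar>h ((t - a) + (a + s)) - h (t - a)\<bar> \<le> 1" "\<bar>h ((t - a) + a) - h (t - a)\<bar> \<le> 1"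
      unfolding F_def by blast+
    moreover have "(t - a) + (a + s) = t + s" "(t - a) + a = t" by auto
    ultimately show ?thesis by auto
  qed
  have chain: "\<bar>h (t + s) - h t\<bar> \<le> 2 * real j" if "t \<ge> R" "0 \<le> s" "s \<le> real j * d" for t s j
    using that
  proof (induction j arbitrary: t s)
    case 0
    then show ?case by simp
  next
    case (Suc j)
    show ?case
    proof (cases "s \<le> d")
      case True
      then show ?thesis using small[of t s] Suc.prems by auto
    next
      case False
      have "\<bar>h ((t + d) + (s - d)) - h (t + d)\<bar> \<le> 2 * real j"
        using Suc.prems False d by (intro Suc.IH) (auto simp: algebra_simps)
      with small[of t d] Suc.prems d show ?thesis by auto
    qed
  qed
  obtain j :: nat where "1 < real j * d" using reals_Archimedean3[OF d] by blast
  then show thesis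
    using chain by (intro that[of R "2 * real j"]) (auto simp: R_def)
qed

text \<open>
  Away from 0 the increments over unit steps are at most \<open>\<epsilon>\<close>, so over a distance \<open>s\<close> they add up to
  at most \<open>\<epsilon> * s\<close>, apart from a last incomplete step.  On the initial stretch, where nothing is
  known about the increments, \<open>h\<close> is assumed bounded.
\<close>

lemma increment_bound_of_vanishing_increments:
  fixes h :: "real \<Rightarrow> real"
  assumes cont: "continuous_on {0<..} h"
    and lim: "\<And>s. ((\<lambda>t. h (t + s) - h t) \<longlongrightarrow> 0) at_top"
    and bdd: "\<And>R. \<exists>D. \<forall>t\<in>{0<..R}. \<bar>h t\<bar> \<le> D"
    and "\<epsilon> > 0"
  obtains C where "C \<ge> 0" "\<And>t s. 0 < t \<Longrightarrow> 0 \<le> s \<Longrightarrow> \<bar>h (t + s) - h t\<bar> \<le> \<epsilon> * s + C"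
proof -
  obtain R1 C1 where R1: "R1 > 0" "C1 \<ge> 0"
    and C1: "\<And>t s. t \<ge> R1 \<Longrightarrow> 0 \<le> s \<Longrightarrow> s \<le> 1 \<Longrightarrow> \<bar>h (t + s) - h t\<bar> \<le> C1"
    using eventually_uniform_increment_bound[OF cont lim] by metis
  have "\<forall>\<^sub>F t in at_top. \<bar>h (t + 1) - h t\<bar> < \<epsilon>"
    using tendstoD[OF lim[of 1] \<open>\<epsilon> > 0\<close>] by (simp add: dist_real_def)
  then obtain N where N: "\<And>t. t \<ge> N \<Longrightarrow> \<bar>h (t + 1) - h t\<bar> < \<epsilon>"
    by (auto simp: eventually_at_top_linorder)
  define R where "R = max R1 N"
  have steps: "\<bar>h (t + real j) - h t\<bar> \<le> \<epsilon> * real j" if "t \<ge> R" for t j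
  proof (induction j)
    case (Suc j)
    have "\<bar>h (t + real j + 1) - h (t + real j)\<bar> < \<epsilon>"
      using that by (intro N) (auto simp: R_def)
    with Suc show ?case by (simp add: algebra_simps)
  qed auto
  have far: "\<bar>h (t + s) - h t\<bar> \<le> \<epsilon> * s + C1" if "t \<ge> R" "0 \<le> s" for t s
  proof -
    define j where "j = nat \<lfloor>s\<rfloor>"
    have j: "real j \<le> s" "s - real j \<le> 1" using that(2) by (auto simp: j_def) linarith
    have "\<bar>h (t + real j + (s - real j)) - h (t + real j)\<bar> \<le> C1"
      using j that by (intro C1) (auto simp: R_def)
    moreover have "\<epsilon> * real j \<le> \<epsilon> * s" using j \<open>\<epsilon> > 0\<close> by simp
    ultimately show ?thesis using steps[OF that(1), of j] by simp
  qed
  obtain D where D: "\<forall>t\<in>{0<..R}. \<bar>h t\<bar> \<le> D" using bdd by blast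
  have "D \<ge> 0" using D R1 by (force simp: R_def)
  show thesis
  proof (rule that[of "C1 + 2 * D"])
    fix t s :: real assume ts: "0 < t" "0 \<le> s"
    consider "t \<ge> R" | "t + s \<le> R" | "t < R" "R < t + s" by linarith
    then show "\<bar>h (t + s) - h t\<bar> \<le> \<epsilon> * s + (C1 + 2 * D)"
    proof cases
      case 1
      then show ?thesis using far[OF 1 ts(2)] \<open>D \<ge> 0\<close> by simp
    next
      case 2
      then have "\<bar>h (t + s)\<bar> \<le> D" "\<bar>h t\<bar> \<le> D" using D ts by auto
      moreover have "0 \<le> \<epsilon> * s" using \<open>\<epsilon> > 0\<close> ts by simp
      ultimately show ?thesis using R1(2) by linarith
    next
      case 3
      then have "\<bar>h R\<bar> \<le> D" "\<bar>h t\<bar> \<le> D" using D ts by auto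
      moreover have "\<bar>h (R + (t + s - R)) - h R\<bar> \<le> \<epsilon> * (t + s - R) + C1"
        using 3 by (intro far) auto
      moreover have "\<epsilon> * (t + s - R) \<le> \<epsilon> * s" using \<open>\<epsilon> > 0\<close> 3 by simp
      ultimately show ?thesis by (simp add: algebra_simps)
    qed
  qed (use \<open>D \<ge> 0\<close> R1 in auto)
qed

text \<open>
  The increment bound for \<open>h t = ln (L (exp t))\<close>, exponentiated.  Two-sided bounds of \<open>L\<close> near 1 make
  the estimate hold on all of \<open>{1<..}\<close>, with no threshold.
\<close>

lemma slowly_varying_Potter:
  fixes L :: "real \<Rightarrow> real"
  assumes pos: "\<And>y. y > 1 \<Longrightarrow> L y > 0"
    and cont: "continuous_on {1<..} L"
    and sv: "slowly_varying L"
    and bdd: "\<And>Y. \<exists>m>0. \<exists>K. \<forall>y\<in>{1<..Y}. m \<le> L y \<and> L y \<le> K"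
    and "\<epsilon> > 0"
  obtains A where "A \<ge> 1"
    "\<And>w v. 1 < w \<Longrightarrow> w \<le> v \<Longrightarrow> L v \<le> A * (v / w) powr \<epsilon> * L w"
    "\<And>w v. 1 < w \<Longrightarrow> w \<le> v \<Longrightarrow> L w \<le> A * (v / w) powr \<epsilon> * L v"
proof -
  define h where "h = (\<lambda>t. ln (L (exp t)))"
  have "continuous_on {0<..} h"
    unfolding h_def
  proof (intro continuous_on_ln continuous_on_compose2[OF cont])
    show "\<forall>x\<in>{0<..}. L (exp x) \<noteq> 0" using pos by (metis greaterThan_iff one_less_exp_iff less_irrefl)
  qed (auto intro!: continuous_intros)
  moreover have "((\<lambda>t. h (t + s) - h t) \<longlongrightarrow> 0) at_top" for s
  proof -
    have "((\<lambda>y. L (exp s * y) / L y) \<longlongrightarrow> 1) at_top"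
      using sv by (auto simp: slowly_varying_def)
    then have "((\<lambda>y. ln (L (exp s * y) / L y)) \<longlongrightarrow> ln 1) at_top"
      by (rule tendsto_ln) simp
    from filterlim_compose[OF this exp_at_top]
    have lim0: "((\<lambda>t. ln (L (exp s * exp t) / L (exp t))) \<longlongrightarrow> 0) at_top" by simp
    have "\<forall>\<^sub>F t in at_top. t > max 0 (- s)" by (rule eventually_gt_at_top)
    then have "\<forall>\<^sub>F t in at_top. ln (L (exp s * exp t) / L (exp t)) = h (t + s) - h t"
    proof eventually_elim
      case (elim t)
      then have "L (exp (t + s)) > 0" "L (exp t) > 0" by (auto intro!: pos)
      then show ?case by (simp add: h_def ln_div exp_add mult.commute)
    qed
    then show ?thesis using lim0 by (rule Lim_transform_eventually[rotated])
  qed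
  moreover have "\<exists>D. \<forall>t\<in>{0<..R}. \<bar>h t\<bar> \<le> D" for R
  proof -
    obtain m K where m: "m > 0" and mK: "\<forall>y\<in>{1<..exp R}. m \<le> L y \<and> L y \<le> K"
      using bdd by blast
    have "\<bar>h t\<bar> \<le> \<bar>ln m\<bar> + \<bar>ln K\<bar>" if "t \<in> {0<..R}" for t
    proof -
      have *: "m \<le> L (exp t)" "L (exp t) \<le> K" using mK that by auto
      then have "ln m \<le> h t" "h t \<le> ln K" using m unfolding h_def by auto
      then show ?thesis by linarith
    qed
    then show ?thesis by blast
  qed
  ultimately obtain C where C: "C \<ge> 0"
    "\<And>t s. 0 < t \<Longrightarrow> 0 \<le> s \<Longrightarrow> \<bar>h (t + s) - h t\<bar> \<le> \<epsilon> * s + C"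
    using increment_bound_of_vanishing_increments[of h \<epsilon>] \<open>\<epsilon> > 0\<close> by metis
  have key: "\<bar>ln (L v) - ln (L w)\<bar> \<le> \<epsilon> * ln (v / w) + C" if "1 < w" "w \<le> v" for w v
    using C(2)[of "ln w" "ln (v / w)"] that by (simp add: h_def ln_div)
  have expand: "exp C * (v / w) powr \<epsilon> * L u = exp (\<epsilon> * ln (v / w) + C + ln (L u))"
    if "1 < w" "w \<le> v" "1 < u" for u v w
    using that pos[of u] by (simp add: exp_add powr_def)
  show thesis
  proof (rule that[of "exp C"])
    fix w v :: real assume wv: "1 < w" "w \<le> v"
    have "L v = exp (ln (L v))" "L w = exp (ln (L w))" using pos wv by auto
    then show "L v \<le> exp C * (v / w) powr \<epsilon> * L w" "L w \<le> exp C * (v / w) powr \<epsilon> * L v"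
      using key[OF wv] wv expand[OF wv, of w] expand[OF wv, of v]
      by (auto simp: abs_le_iff) (smt (verit) exp_le_cancel_iff)+
  qed (use C in auto)
qed

section \<open>Truncated moments and the tail\<close>

definition trunc_moment :: "'a measure \<Rightarrow> ('a \<Rightarrow> real) \<Rightarrow> nat \<Rightarrow> real \<Rightarrow> real" where
  "trunc_moment M \<xi> p y = (\<integral>\<omega>. min \<bar>\<xi> \<omega>\<bar> y ^ p \<partial>M)"

context prob_space
begin

lemma tail_fun_nonneg: "0 \<le> tail_fun M \<xi> x"
  by (simp add: tail_fun_def)

lemma tail_fun_le_1: "tail_fun M \<xi> x \<le> 1"
  by (simp add: tail_fun_def)

lemma tail_fun_antimono:
  fixes \<xi> :: "'a \<Rightarrow> real"
  assumes [measurable]: "\<xi> \<in> borel_measurable M" and "x \<le> y"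
  shows "tail_fun M \<xi> y \<le> tail_fun M \<xi> x"
  unfolding tail_fun_def using assms(2) by (intro finite_measure_mono) auto

lemma integrable_min_power:
  fixes \<xi> :: "'a \<Rightarrow> real"
  assumes [measurable]: "\<xi> \<in> borel_measurable M" and "0 \<le> y"
  shows "integrable M (\<lambda>\<omega>. min \<bar>\<xi> \<omega>\<bar> y ^ p)"
  using assms(2) by (intro integrable_const_bound[where B = "y ^ p"]) (auto intro!: power_mono)

lemma trunc_moment_mono:
  fixes \<xi> :: "'a \<Rightarrow> real"
  assumes [measurable]: "\<xi> \<in> borel_measurable M" and "0 \<le> a" "a \<le> y"
  shows "trunc_moment M \<xi> p a \<le> trunc_moment M \<xi> p y"
  unfolding trunc_moment_def using assms(2,3)
  by (intro integral_mono integrable_min_power power_mono) auto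

lemma trunc_moment_nonneg: "0 \<le> y \<Longrightarrow> 0 \<le> trunc_moment M \<xi> p y"
  unfolding trunc_moment_def by (intro integral_nonneg_AE) auto

lemma power_times_tail_le_trunc_moment:
  fixes \<xi> :: "'a \<Rightarrow> real"
  assumes [measurable]: "\<xi> \<in> borel_measurable M" and "0 \<le> y"
  shows "y ^ p * tail_fun M \<xi> y \<le> trunc_moment M \<xi> p y"
proof -
  have "y ^ p * tail_fun M \<xi> y = (\<integral>\<omega>. y ^ p * indicator {\<omega>\<in>space M. y \<le> \<bar>\<xi> \<omega>\<bar>} \<omega> \<partial>M)"
    by (simp add: tail_fun_def)
  also have "\<dots> \<le> trunc_moment M \<xi> p y"
    unfolding trunc_moment_def using assms(2)
    by (intro integral_mono integrable_min_power integrable_mult_right integrable_real_indicator)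
      (auto simp: less_top[symmetric] split: split_indicator)
  finally show ?thesis .
qed

text \<open>
  For each outcome the increment of \<open>min \<bar>\<xi>\<bar> y ^ p\<close> in \<open>y\<close> is the integral of \<open>p * u ^ (p - 1)\<close> over those
  levels \<open>u\<close> that \<open>\<bar>\<xi>\<bar>\<close> reaches; Fubini's theorem turns the average into an integral of the tail.  The
  two comparison lemmas below evaluate this integral through an antiderivative of a bound for
  the integrand.
\<close>

lemma trunc_moment_layer_cake:
  fixes \<xi> :: "'a \<Rightarrow> real"
  assumes [measurable]: "\<xi> \<in> borel_measurable M" and "0 \<le> a" "a \<le> y" "p > 0"
  shows "ennreal (trunc_moment M \<xi> p y - trunc_moment M \<xi> p a) =
    (\<integral>\<^sup>+u. ennreal (real p * u ^ (p - 1) * tail_fun M \<xi> u) * indicator {a..y} u \<partial>lborel)"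
proof -
  interpret P: pair_sigma_finite M lborel ..
  define f where "f = (\<lambda>(\<omega>, u). ennreal (real p * u ^ (p - 1)) * indicator {a..y} u *
    indicator {u. u \<le> \<bar>\<xi> \<omega>\<bar>} u)"
  have f_meas [measurable]: "f \<in> borel_measurable (M \<Otimes>\<^sub>M lborel)"
    unfolding f_def by measurable
  have mono: "min \<bar>\<xi> \<omega>\<bar> a ^ p \<le> min \<bar>\<xi> \<omega>\<bar> y ^ p" for \<omega>
    using assms by (intro power_mono) auto
  have slice: "(\<integral>\<^sup>+u. f (\<omega>, u) \<partial>lborel) = ennreal (min \<bar>\<xi> \<omega>\<bar> y ^ p - min \<bar>\<xi> \<omega>\<bar> a ^ p)" for \<omega>
  proof (cases "a \<le> \<bar>\<xi> \<omega>\<bar>")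
    case True
    have "(\<integral>\<^sup>+u. f (\<omega>, u) \<partial>lborel) =
        (\<integral>\<^sup>+u. ennreal (real p * u ^ (p - 1)) * indicator {a..min \<bar>\<xi> \<omega>\<bar> y} u \<partial>lborel)"
      by (intro nn_integral_cong) (auto simp: f_def split: split_indicator)
    also have "\<dots> = ennreal (min \<bar>\<xi> \<omega>\<bar> y ^ p - a ^ p)"
      using assms True
      by (intro nn_integral_FTC_Icc) (auto intro!: derivative_eq_intros)
    also have "a = min \<bar>\<xi> \<omega>\<bar> a" using True by simp
    finally show ?thesis using True by simp
  next
    case False
    then have "(\<integral>\<^sup>+u. f (\<omega>, u) \<partial>lborel) = (\<integral>\<^sup>+(u::real). 0 \<partial>lborel)"
      by (intro nn_integral_cong) (auto simp: f_def split: split_indicator)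
    with False assms show ?thesis by auto
  qed
  have "ennreal (trunc_moment M \<xi> p y - trunc_moment M \<xi> p a) =
      ennreal (\<integral>\<omega>. min \<bar>\<xi> \<omega>\<bar> y ^ p - min \<bar>\<xi> \<omega>\<bar> a ^ p \<partial>M)"
    unfolding trunc_moment_def using assms
    by (subst Bochner_Integration.integral_diff) (auto intro!: integrable_min_power)
  also have "\<dots> = (\<integral>\<^sup>+\<omega>. ennreal (min \<bar>\<xi> \<omega>\<bar> y ^ p - min \<bar>\<xi> \<omega>\<bar> a ^ p) \<partial>M)"
    using assms mono
    by (intro nn_integral_eq_integral[symmetric] Bochner_Integration.integrable_diff
          integrable_min_power) auto
  also have "\<dots> = (\<integral>\<^sup>+\<omega>. (\<integral>\<^sup>+u. f (\<omega>, u) \<partial>lborel) \<partial>M)" by (simp add: slice)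
  also have "\<dots> = (\<integral>\<^sup>+u. (\<integral>\<^sup>+\<omega>. f (\<omega>, u) \<partial>M) \<partial>lborel)" by (rule P.Fubini'[symmetric]) simp
  also have "\<dots> = (\<integral>\<^sup>+u. ennreal (real p * u ^ (p - 1) * tail_fun M \<xi> u) * indicator {a..y} u \<partial>lborel)"
  proof (intro nn_integral_cong)
    fix u :: real
    have "(\<integral>\<^sup>+\<omega>. f (\<omega>, u) \<partial>M) = (\<integral>\<^sup>+\<omega>. ennreal (real p * u ^ (p - 1)) * indicator {a..y} u *
        indicator {\<omega>\<in>space M. u \<le> \<bar>\<xi> \<omega>\<bar>} \<omega> \<partial>M)"
      by (intro nn_integral_cong) (auto simp: f_def split: split_indicator)
    also have "\<dots> = ennreal (real p * u ^ (p - 1)) * indicator {a..y} u * ennreal (tail_fun M \<xi> u)"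
      by (subst nn_integral_cmult_indicator) (auto simp: tail_fun_def emeasure_eq_measure)
    also have "\<dots> = ennreal (real p * u ^ (p - 1) * tail_fun M \<xi> u) * indicator {a..y} u"
      using assms tail_fun_nonneg[of \<xi> u]
      by (auto simp: ennreal_mult' ennreal_mult'' split: split_indicator)
    finally show "(\<integral>\<^sup>+\<omega>. f (\<omega>, u) \<partial>M) = \<dots>" .
  qed
  finally show ?thesis .
qed

lemma trunc_moment_diff_le:
  fixes \<xi> :: "'a \<Rightarrow> real"
  assumes [measurable]: "\<xi> \<in> borel_measurable M" and "0 \<le> a" "a \<le> y" "p > 0"
    and f: "f \<in> borel_measurable borel" "\<And>u. a \<le> u \<Longrightarrow> u \<le> y \<Longrightarrow> DERIV F u :> f u"
    and le: "\<And>u. a \<le> u \<Longrightarrow> u \<le> y \<Longrightarrow> real p * u ^ (p - 1) * tail_fun M \<xi> u \<le> f u"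
  shows "trunc_moment M \<xi> p y - trunc_moment M \<xi> p a \<le> F y - F a"
proof -
  have nonneg: "0 \<le> f u" if "a \<le> u" "u \<le> y" for u
    using le[OF that] that assms(2) tail_fun_nonneg[of \<xi> u]
    by (meson mult_nonneg_nonneg of_nat_0_le_iff order_trans zero_le_power)
  have "F a \<le> F y"
    using f nonneg \<open>a \<le> y\<close> by (intro DERIV_nonneg_imp_nondecreasing[of a y F]) auto
  have "ennreal (trunc_moment M \<xi> p y - trunc_moment M \<xi> p a) \<le>
      (\<integral>\<^sup>+u. ennreal (f u) * indicator {a..y} u \<partial>lborel)"
    unfolding trunc_moment_layer_cake[OF assms(1-4)] using le
    by (intro nn_integral_mono) (auto intro!: ennreal_leI split: split_indicator)
  also have "\<dots> = ennreal (F y - F a)"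
    using f nonneg \<open>a \<le> y\<close> by (intro nn_integral_FTC_Icc) auto
  finally show ?thesis using \<open>F a \<le> F y\<close> by simp
qed

lemma trunc_moment_diff_ge:
  fixes \<xi> :: "'a \<Rightarrow> real"
  assumes [measurable]: "\<xi> \<in> borel_measurable M" and "0 \<le> a" "a \<le> y" "p > 0"
    and f: "f \<in> borel_measurable borel" "\<And>u. a \<le> u \<Longrightarrow> u \<le> y \<Longrightarrow> DERIV F u :> f u"
    and nonneg: "\<And>u. a \<le> u \<Longrightarrow> u \<le> y \<Longrightarrow> 0 \<le> f u"
    and ge: "\<And>u. a \<le> u \<Longrightarrow> u \<le> y \<Longrightarrow> f u \<le> real p * u ^ (p - 1) * tail_fun M \<xi> u"
  shows "F y - F a \<le> trunc_moment M \<xi> p y - trunc_moment M \<xi> p a"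
proof -
  have "ennreal (F y - F a) = (\<integral>\<^sup>+u. ennreal (f u) * indicator {a..y} u \<partial>lborel)"
    using f nonneg \<open>a \<le> y\<close> by (intro nn_integral_FTC_Icc[symmetric]) auto
  also have "\<dots> \<le> ennreal (trunc_moment M \<xi> p y - trunc_moment M \<xi> p a)"
    unfolding trunc_moment_layer_cake[OF assms(1-4)] using ge
    by (intro nn_integral_mono) (auto intro!: ennreal_leI split: split_indicator)
  finally show ?thesis using trunc_moment_mono[OF assms(1-3), of p] by simp
qed

end

section \<open>Tails of sums of independent symmetric variables\<close>

context prob_space
begin

text \<open>
  Expanding powers of \<open>Y i + S\<close>, every term containing \<open>Y i\<close> or \<open>S\<close> to the first power vanishes, since
  both are centred.  Thus a fourth moment grows by one fourth moment and by six times a product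
  of second moments, and the square \<open>3 * (card I * s) ^ 2\<close> absorbs these products.
\<close>

lemma moments_of_independent_sum:
  fixes Y :: "'i \<Rightarrow> 'a \<Rightarrow> real" and B s q :: real
  assumes "finite I" "indep_vars (\<lambda>_. borel) Y I"
    and bdd: "\<And>i \<omega>. i \<in> I \<Longrightarrow> \<bar>Y i \<omega>\<bar> \<le> B"
    and mean: "\<And>i. i \<in> I \<Longrightarrow> expectation (Y i) = 0"
    and snd: "\<And>i. i \<in> I \<Longrightarrow> expectation (\<lambda>\<omega>. Y i \<omega> ^ 2) \<le> s"
    and fourth: "\<And>i. i \<in> I \<Longrightarrow> expectation (\<lambda>\<omega>. Y i \<omega> ^ 4) \<le> q"
  shows "expectation (\<lambda>\<omega>. \<Sum>i\<in>I. Y i \<omega>) = 0 \<and>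
    expectation (\<lambda>\<omega>. (\<Sum>i\<in>I. Y i \<omega>) ^ 2) \<le> card I * s \<and>
    expectation (\<lambda>\<omega>. (\<Sum>i\<in>I. Y i \<omega>) ^ 4) \<le> card I * q + 3 * (card I * s) ^ 2"
  using assms
proof (induction I)
  case empty
  then show ?case by simp
next
  case (insert i I)
  define S where "S = (\<lambda>\<omega>. \<Sum>j\<in>I. Y j \<omega>)"
  have Y_meas [measurable]: "Y j \<in> borel_measurable M" if "j \<in> insert i I" for j
    using insert.prems(1) that by (auto simp: indep_vars_def)
  have S_meas [measurable]: "S \<in> borel_measurable M"
    unfolding S_def by (intro borel_measurable_sum Y_meas) auto
  have Yi_meas [measurable]: "Y i \<in> borel_measurable M" by (rule Y_meas) simp
  have IH: "expectation S = 0" "expectation (\<lambda>\<omega>. S \<omega> ^ 2) \<le> card I * s"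
    "expectation (\<lambda>\<omega>. S \<omega> ^ 4) \<le> card I * q + 3 * (card I * s) ^ 2"
    using insert.IH[OF indep_vars_subset[OF insert.prems(1)]] insert.prems unfolding S_def by auto
  have S_bdd: "\<bar>S \<omega>\<bar> \<le> card I * B" for \<omega>
  proof -
    have "\<bar>S \<omega>\<bar> \<le> (\<Sum>j\<in>I. \<bar>Y j \<omega>\<bar>)" unfolding S_def by (rule sum_abs)
    also have "\<dots> \<le> (\<Sum>j\<in>I. B)" using insert.prems(2) by (intro sum_mono) auto
    finally show ?thesis by simp
  qed
  have int_S: "integrable M (\<lambda>\<omega>. S \<omega> ^ k)" for k
    using S_bdd by (intro integrable_const_bound[where B = "(card I * B) ^ k"] AE_I2)
      (auto simp: power_abs intro!: power_mono)
  have int_Y: "integrable M (\<lambda>\<omega>. Y i \<omega> ^ k)" for k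
    using insert.prems(2)[of i] by (intro integrable_const_bound[where B = "B ^ k"] AE_I2)
      (auto simp: power_abs intro!: power_mono)
  have "indep_var borel (Y i) borel S"
    unfolding S_def using insert by (intro indep_vars_sum) auto
  then have indep: "indep_var borel (\<lambda>\<omega>. Y i \<omega> ^ k) borel (\<lambda>\<omega>. S \<omega> ^ l)" for k l
    using indep_var_compose[of borel "Y i" borel S "\<lambda>x. x ^ k" borel "\<lambda>x. x ^ l" borel]
    by (simp add: comp_def)
  have E_prod: "expectation (\<lambda>\<omega>. Y i \<omega> ^ k * S \<omega> ^ l) =
      expectation (\<lambda>\<omega>. Y i \<omega> ^ k) * expectation (\<lambda>\<omega>. S \<omega> ^ l)"
    and int_prod: "integrable M (\<lambda>\<omega>. Y i \<omega> ^ k * S \<omega> ^ l)" for k l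
    using indep_var_lebesgue_integral[OF indep int_Y int_S] indep_var_integrable[OF indep int_Y int_S]
    by auto
  have EY: "expectation (Y i) = 0" "expectation (\<lambda>\<omega>. Y i \<omega> ^ 2) \<le> s"
    "expectation (\<lambda>\<omega>. Y i \<omega> ^ 4) \<le> q"
    using insert.prems by auto
  have split: "(\<Sum>j\<in>insert i I. Y j \<omega>) = Y i \<omega> + S \<omega>" for \<omega>
    using insert.hyps by (simp add: S_def)
  have card: "real (card (insert i I)) = real (card I) + 1" using insert.hyps by simp
  have "0 \<le> expectation (\<lambda>\<omega>. Y i \<omega> ^ 2)" by (intro integral_nonneg_AE) auto
  then have "s \<ge> 0" using EY(2) by linarith
  have m1: "expectation (\<lambda>\<omega>. Y i \<omega> + S \<omega>) = 0"
    using int_Y[of 1] int_S[of 1] EY(1) IH(1) by simp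
  have "expectation (\<lambda>\<omega>. (Y i \<omega> + S \<omega>) ^ 2) =
      expectation (\<lambda>\<omega>. Y i \<omega> ^ 2 + 2 * (Y i \<omega> ^ 1 * S \<omega> ^ 1) + S \<omega> ^ 2)"
    by (intro Bochner_Integration.integral_cong refl) (simp add: power2_eq_square algebra_simps)
  also have "\<dots> = expectation (\<lambda>\<omega>. Y i \<omega> ^ 2) + expectation (\<lambda>\<omega>. S \<omega> ^ 2)"
    using int_Y[of 2] int_S[of 2] int_prod[of 1 1] E_prod[of 1 1] EY(1) by simp
  finally have m2: "expectation (\<lambda>\<omega>. (Y i \<omega> + S \<omega>) ^ 2) \<le> (card I + 1) * s"
    using EY(2) IH(2) by (simp add: algebra_simps)
  have "expectation (\<lambda>\<omega>. (Y i \<omega> + S \<omega>) ^ 4) =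
      expectation (\<lambda>\<omega>. Y i \<omega> ^ 4 + 4 * (Y i \<omega> ^ 3 * S \<omega> ^ 1) + 6 * (Y i \<omega> ^ 2 * S \<omega> ^ 2) +
        4 * (Y i \<omega> ^ 1 * S \<omega> ^ 3) + S \<omega> ^ 4)"
    by (intro Bochner_Integration.integral_cong refl)
      (simp add: power2_eq_square power3_eq_cube power4_eq_xxxx algebra_simps)
  also have "\<dots> = expectation (\<lambda>\<omega>. Y i \<omega> ^ 4) +
      6 * (expectation (\<lambda>\<omega>. Y i \<omega> ^ 2) * expectation (\<lambda>\<omega>. S \<omega> ^ 2)) + expectation (\<lambda>\<omega>. S \<omega> ^ 4)"
    using int_Y[of 4] int_S[of 4] int_prod[of 3 1] int_prod[of 2 2] int_prod[of 1 3]
      E_prod[of 3 1] E_prod[of 2 2] E_prod[of 1 3] EY(1) IH(1) by simp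
  also have "\<dots> \<le> q + 6 * (s * (card I * s)) + (card I * q + 3 * (card I * s) ^ 2)"
    using EY IH \<open>s \<ge> 0\<close> by (intro add_mono mult_left_mono mult_mono) (auto intro!: integral_nonneg_AE)
  also have "\<dots> \<le> (card I + 1) * q + 3 * ((card I + 1) * s) ^ 2"
    by (simp add: power2_eq_square algebra_simps)
  finally have m4: "expectation (\<lambda>\<omega>. (Y i \<omega> + S \<omega>) ^ 4) \<le> (card I + 1) * q + 3 * ((card I + 1) * s) ^ 2" .
  show ?case unfolding split card using m1 m2 m4 by (simp add: algebra_simps)
qed

lemma symmetric_rv_expectation_odd:
  fixes \<xi> :: "'a \<Rightarrow> real" and f :: "real \<Rightarrow> real"
  assumes [measurable]: "\<xi> \<in> borel_measurable M" and "symmetric_rv M \<xi>"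
    and [measurable]: "f \<in> borel_measurable borel" and odd: "\<And>x. f (- x) = - f x"
  shows "expectation (\<lambda>\<omega>. f (\<xi> \<omega>)) = 0"
proof -
  have "expectation (\<lambda>\<omega>. f (\<xi> \<omega>)) = (\<integral>x. f x \<partial>distr M borel \<xi>)"
    by (simp add: integral_distr)
  also have "\<dots> = (\<integral>x. f x \<partial>distr M borel (\<lambda>\<omega>. - \<xi> \<omega>))"
    using assms(2) by (simp add: symmetric_rv_def)
  also have "\<dots> = - expectation (\<lambda>\<omega>. f (\<xi> \<omega>))"
    by (simp add: integral_distr odd)
  finally show ?thesis by simp
qed

lemma tail_fun_eq_distr:
  assumes [measurable]: "\<xi> \<in> borel_measurable M"
  shows "tail_fun M \<xi> z = measure (distr M borel \<xi>) {x. z \<le> \<bar>x\<bar>}"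
  by (simp add: tail_fun_def measure_distr) (intro arg_cong[where f = prob], auto)

text \<open>
  Each summand is cut off at the level \<open>z\<close> itself.  Either some summand reaches \<open>z\<close>, or the sum of
  the cut-off variables does, which Markov's inequality controls through second or fourth moments.
\<close>

lemma
  fixes \<xi> :: "'a \<Rightarrow> real" and X :: "'i \<Rightarrow> 'a \<Rightarrow> real"
  assumes \<xi> [measurable]: "\<xi> \<in> borel_measurable M" and sym: "symmetric_rv M \<xi>"
    and I: "finite I" and indep: "indep_vars (\<lambda>_. borel) X I"
    and copies: "\<And>i. i \<in> I \<Longrightarrow> distr M borel (X i) = distr M borel \<xi>"
    and "z > 0"
  shows tail_sum_le_second_moment: "tail_fun M (\<lambda>\<omega>. \<Sum>i\<in>I. X i \<omega>) z \<le>
      card I * tail_fun M \<xi> z + card I * trunc_moment M \<xi> 2 z / z ^ 2"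
    and tail_sum_le_fourth_moment: "tail_fun M (\<lambda>\<omega>. \<Sum>i\<in>I. X i \<omega>) z \<le>
      card I * tail_fun M \<xi> z +
      (card I * trunc_moment M \<xi> 4 z + 3 * (card I * trunc_moment M \<xi> 2 z) ^ 2) / z ^ 4"
proof -
  define f where "f = (\<lambda>x::real. if \<bar>x\<bar> < z then x else 0)"
  have f_meas [measurable]: "f \<in> borel_measurable borel" unfolding f_def by measurable
  define Y where "Y = (\<lambda>i \<omega>. f (X i \<omega>))"
  define S where "S = (\<lambda>\<omega>. \<Sum>i\<in>I. Y i \<omega>)"
  have X_meas [measurable]: "X i \<in> borel_measurable M" if "i \<in> I" for i
    using indep that by (auto simp: indep_vars_def)
  have Y_meas [measurable]: "Y i \<in> borel_measurable M" if "i \<in> I" for i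
    unfolding Y_def using X_meas[OF that] by measurable
  have S_meas [measurable]: "S \<in> borel_measurable M"
    unfolding S_def by (intro borel_measurable_sum Y_meas)
  have sum_meas [measurable]: "(\<lambda>\<omega>. \<Sum>i\<in>I. X i \<omega>) \<in> borel_measurable M"
    by (intro borel_measurable_sum X_meas)
  have Y_bdd: "\<bar>Y i \<omega>\<bar> \<le> z" for i \<omega> using \<open>z > 0\<close> by (auto simp: Y_def f_def)
  have E_copy: "expectation (\<lambda>\<omega>. g (Y i \<omega>)) = expectation (\<lambda>\<omega>. g (f (\<xi> \<omega>)))"
    if "i \<in> I" and [measurable]: "g \<in> borel_measurable borel" for i and g :: "real \<Rightarrow> real"
  proof -
    have [measurable]: "X i \<in> borel_measurable M" by (rule X_meas[OF that(1)])
    have "expectation (\<lambda>\<omega>. g (Y i \<omega>)) = (\<integral>x. g (f x) \<partial>distr M borel (X i))"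
      by (simp add: integral_distr Y_def)
    also have "\<dots> = expectation (\<lambda>\<omega>. g (f (\<xi> \<omega>)))"
      by (simp add: integral_distr copies[OF that(1)])
    finally show ?thesis .
  qed
  have f_mom: "expectation (\<lambda>\<omega>. f (\<xi> \<omega>) ^ p) \<le> trunc_moment M \<xi> p z" if "even p" for p
    unfolding trunc_moment_def
  proof (intro integral_mono)
    show "integrable M (\<lambda>\<omega>. f (\<xi> \<omega>) ^ p)"
      using \<open>z > 0\<close> by (intro integrable_const_bound[where B = "z ^ p"] AE_I2)
        (auto simp: f_def power_abs power_0_left intro!: power_mono)
    show "f (\<xi> \<omega>) ^ p \<le> min \<bar>\<xi> \<omega>\<bar> z ^ p" for \<omega>
    proof -
      have "f (\<xi> \<omega>) ^ p = \<bar>f (\<xi> \<omega>)\<bar> ^ p" using that by (simp add: power_even_abs)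
      also have "\<dots> \<le> min \<bar>\<xi> \<omega>\<bar> z ^ p" using \<open>z > 0\<close> by (intro power_mono) (auto simp: f_def)
      finally show ?thesis .
    qed
  qed (use \<open>z > 0\<close> in \<open>auto intro!: integrable_min_power\<close>)
  have "indep_vars (\<lambda>_. borel) Y I"
    unfolding Y_def using indep by (rule indep_vars_compose2) simp
  moreover have "expectation (Y i) = 0" if "i \<in> I" for i
    using E_copy[OF that, of "\<lambda>x. x"] symmetric_rv_expectation_odd[OF \<xi> sym f_meas]
    by (auto simp: f_def)
  moreover have "expectation (\<lambda>\<omega>. Y i \<omega> ^ p) \<le> trunc_moment M \<xi> p z" if "i \<in> I" "even p" for i p
    using E_copy[OF that(1), of "\<lambda>x. x ^ p"] f_mom[OF that(2)] by simp
  ultimately have mom: "expectation (\<lambda>\<omega>. S \<omega> ^ 2) \<le> card I * trunc_moment M \<xi> 2 z"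
    "expectation (\<lambda>\<omega>. S \<omega> ^ 4) \<le>
       card I * trunc_moment M \<xi> 4 z + 3 * (card I * trunc_moment M \<xi> 2 z) ^ 2"
    using moments_of_independent_sum[of I Y z "trunc_moment M \<xi> 2 z" "trunc_moment M \<xi> 4 z"] I Y_bdd
    unfolding S_def by auto
  have S_bdd: "\<bar>S \<omega>\<bar> \<le> card I * z" for \<omega>
  proof -
    have "\<bar>S \<omega>\<bar> \<le> (\<Sum>i\<in>I. \<bar>Y i \<omega>\<bar>)" unfolding S_def by (rule sum_abs)
    also have "\<dots> \<le> (\<Sum>i\<in>I. z)" using Y_bdd by (intro sum_mono)
    finally show ?thesis by simp
  qed
  have markov: "tail_fun M S z \<le> expectation (\<lambda>\<omega>. S \<omega> ^ p) / z ^ p" if "even p" for p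
  proof -
    have abs: "S \<omega> ^ p = \<bar>S \<omega>\<bar> ^ p" for \<omega> using that by (simp add: power_even_abs)
    have int: "integrable M (\<lambda>\<omega>. S \<omega> ^ p)"
      using S_bdd by (intro integrable_const_bound[where B = "(card I * z) ^ p"] AE_I2)
        (auto simp: power_abs intro!: power_mono)
    have "tail_fun M S z \<le> prob {\<omega> \<in> space M. z ^ p \<le> S \<omega> ^ p}"
      unfolding tail_fun_def using \<open>z > 0\<close>
      by (intro finite_measure_mono) (auto simp: abs intro!: power_mono)
    also have "\<dots> \<le> expectation (\<lambda>\<omega>. S \<omega> ^ p) / z ^ p"
      using \<open>z > 0\<close> int that
      by (intro integral_Markov_inequality_measure[where A = "space M"]) (auto simp: zero_le_even_power)
    finally show ?thesis .
  qed
  have union: "tail_fun M (\<lambda>\<omega>. \<Sum>i\<in>I. X i \<omega>) z \<le> card I * tail_fun M \<xi> z + tail_fun M S z"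
  proof -
    have big: "{\<omega>\<in>space M. z \<le> \<bar>X i \<omega>\<bar>} \<in> events" if "i \<in> I" for i
      using X_meas[OF that] by measurable
    have "{\<omega>\<in>space M. z \<le> \<bar>\<Sum>i\<in>I. X i \<omega>\<bar>} \<subseteq>
        (\<Union>i\<in>I. {\<omega>\<in>space M. z \<le> \<bar>X i \<omega>\<bar>}) \<union> {\<omega>\<in>space M. z \<le> \<bar>S \<omega>\<bar>}"
    proof
      fix \<omega> assume \<omega>: "\<omega> \<in> {\<omega>\<in>space M. z \<le> \<bar>\<Sum>i\<in>I. X i \<omega>\<bar>}"
      show "\<omega> \<in> (\<Union>i\<in>I. {\<omega>\<in>space M. z \<le> \<bar>X i \<omega>\<bar>}) \<union> {\<omega>\<in>space M. z \<le> \<bar>S \<omega>\<bar>}"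
      proof (rule UnCI, rule ccontr)
        assume "\<omega> \<notin> {\<omega>\<in>space M. z \<le> \<bar>S \<omega>\<bar>}" "\<omega> \<notin> (\<Union>i\<in>I. {\<omega>\<in>space M. z \<le> \<bar>X i \<omega>\<bar>})"
        then have S_small: "\<not> z \<le> \<bar>S \<omega>\<bar>" and X_small: "\<And>i. i \<in> I \<Longrightarrow> \<not> z \<le> \<bar>X i \<omega>\<bar>"
          using \<omega> by auto
        have "Y i \<omega> = X i \<omega>" if "i \<in> I" for i using X_small[OF that] by (simp add: Y_def f_def)
        then have "S \<omega> = (\<Sum>i\<in>I. X i \<omega>)" unfolding S_def by (intro sum.cong) auto
        with \<omega> S_small show False by simp
      qed
    qed
    then have "tail_fun M (\<lambda>\<omega>. \<Sum>i\<in>I. X i \<omega>) z \<le>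
        prob ((\<Union>i\<in>I. {\<omega>\<in>space M. z \<le> \<bar>X i \<omega>\<bar>}) \<union> {\<omega>\<in>space M. z \<le> \<bar>S \<omega>\<bar>})"
      unfolding tail_fun_def using big I by (intro finite_measure_mono) (auto intro!: sets.finite_UN)
    also have "\<dots> \<le> prob (\<Union>i\<in>I. {\<omega>\<in>space M. z \<le> \<bar>X i \<omega>\<bar>}) + tail_fun M S z"
      unfolding tail_fun_def using big I by (intro measure_Un_le) (auto intro!: sets.finite_UN)
    also have "prob (\<Union>i\<in>I. {\<omega>\<in>space M. z \<le> \<bar>X i \<omega>\<bar>}) \<le> (\<Sum>i\<in>I. tail_fun M (X i) z)"
      unfolding tail_fun_def using big I by (intro finite_measure_subadditive_finite) auto
    also have "\<dots> = (\<Sum>i\<in>I. tail_fun M \<xi> z)"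
      by (intro sum.cong refl) (simp add: tail_fun_eq_distr copies X_meas)
    finally show ?thesis by simp
  qed
  show "tail_fun M (\<lambda>\<omega>. \<Sum>i\<in>I. X i \<omega>) z \<le>
      card I * tail_fun M \<xi> z + card I * trunc_moment M \<xi> 2 z / z ^ 2"
    using union markov[of 2] divide_right_mono[OF mom(1), of "z ^ 2"] by simp
  show "tail_fun M (\<lambda>\<omega>. \<Sum>i\<in>I. X i \<omega>) z \<le> card I * tail_fun M \<xi> z +
      (card I * trunc_moment M \<xi> 4 z + 3 * (card I * trunc_moment M \<xi> 2 z) ^ 2) / z ^ 4"
    using union markov[of 4] divide_right_mono[OF mom(2), of "z ^ 4"] by simp
qed

text \<open>
  A crude bound, in which the number of summands enters the level: it suits a fixed number of
  summands.
\<close>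

lemma tail_sum_le_max:
  fixes \<xi> :: "'a \<Rightarrow> real" and X :: "'i \<Rightarrow> 'a \<Rightarrow> real"
  assumes \<xi> [measurable]: "\<xi> \<in> borel_measurable M"
    and I: "finite I" and X_meas: "\<And>i. i \<in> I \<Longrightarrow> X i \<in> borel_measurable M"
    and copies: "\<And>i. i \<in> I \<Longrightarrow> distr M borel (X i) = distr M borel \<xi>"
    and "z > 0"
  shows "tail_fun M (\<lambda>\<omega>. \<Sum>i\<in>I. X i \<omega>) z \<le> card I * tail_fun M \<xi> (z / card I)"
proof (cases "I = {}")
  case True
  then show ?thesis using \<open>z > 0\<close> by (simp add: tail_fun_def)
next
  case False
  have big: "{\<omega>\<in>space M. z / card I \<le> \<bar>X i \<omega>\<bar>} \<in> events" if "i \<in> I" for i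
    using X_meas[OF that] by measurable
  have "{\<omega>\<in>space M. z \<le> \<bar>\<Sum>i\<in>I. X i \<omega>\<bar>} \<subseteq> (\<Union>i\<in>I. {\<omega>\<in>space M. z / card I \<le> \<bar>X i \<omega>\<bar>})"
  proof
    fix \<omega> assume "\<omega> \<in> {\<omega>\<in>space M. z \<le> \<bar>\<Sum>i\<in>I. X i \<omega>\<bar>}"
    then have \<omega>: "\<omega> \<in> space M" "z \<le> \<bar>\<Sum>i\<in>I. X i \<omega>\<bar>" by auto
    show "\<omega> \<in> (\<Union>i\<in>I. {\<omega>\<in>space M. z / card I \<le> \<bar>X i \<omega>\<bar>})"
    proof (rule ccontr)
      assume "\<omega> \<notin> (\<Union>i\<in>I. {\<omega>\<in>space M. z / card I \<le> \<bar>X i \<omega>\<bar>})"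
      then have "(\<Sum>i\<in>I. \<bar>X i \<omega>\<bar>) < (\<Sum>i\<in>I. z / card I)"
        using I False \<omega>(1) by (intro sum_strict_mono) auto
      also have "\<dots> = z" using I False by simp
      finally show False using \<omega>(2) sum_abs[of "\<lambda>i. X i \<omega>" I] by linarith
    qed
  qed
  then have "tail_fun M (\<lambda>\<omega>. \<Sum>i\<in>I. X i \<omega>) z \<le> prob (\<Union>i\<in>I. {\<omega>\<in>space M. z / card I \<le> \<bar>X i \<omega>\<bar>})"
    unfolding tail_fun_def using big I by (intro finite_measure_mono) (auto intro!: sets.finite_UN)
  also have "\<dots> \<le> (\<Sum>i\<in>I. tail_fun M (X i) (z / card I))"
    unfolding tail_fun_def using big I by (intro finite_measure_subadditive_finite) auto
  also have "\<dots> = (\<Sum>i\<in>I. tail_fun M \<xi> (z / card I))"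
    by (intro sum.cong refl) (simp add: tail_fun_eq_distr copies X_meas)
  finally show ?thesis by simp
qed

end

section \<open>The function psi near the origin\<close>

text \<open>
  Subtracting the indicator makes the left side vanish for \<open>\<bar>y\<bar> \<ge> 1\<close>, where the cosine may return
  to 1, while keeping a truncated square, whose mean is a truncated moment.
\<close>

lemma one_minus_cos_lower_bound:
  fixes y :: real
  shows "(min \<bar>y\<bar> 1 ^ 2 - (if \<bar>y\<bar> \<ge> 1 then 1 else 0)) / 4 \<le> 1 - cos y"
proof (cases "\<bar>y\<bar> < 1")
  case True
  obtain t where "cos y = (\<Sum>m<4. cos_coeff m * y ^ m) + (cos (t + 1/2 * real 4 * pi) / fact 4) * y ^ 4"
    using Maclaurin_cos_expansion[of y 4] by blast
  moreover have "(\<Sum>m<4. cos_coeff m * y ^ m) = 1 - y ^ 2 / 2"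
  proof -
    have "{..<4} = {0, 1, 2, 3 :: nat}" by auto
    then show ?thesis by (simp add: cos_coeff_def)
  qed
  moreover have "(cos (t + 1/2 * real 4 * pi) / fact 4) * y ^ 4 \<le> 1 / 4 * y ^ 2"
  proof -
    have "cos s / 24 \<le> 1 / 4" for s :: real using cos_le_one[of s] by linarith
    moreover have "fact 4 = (24 :: real)" by (simp add: fact_numeral)
    ultimately have "cos (t + 1/2 * real 4 * pi) / fact 4 \<le> 1 / 4" by (simp only:)
    then have "(cos (t + 1/2 * real 4 * pi) / fact 4) * y ^ 4 \<le> 1 / 4 * y ^ 4"
      by (intro mult_right_mono) auto
    moreover have "\<bar>y\<bar> ^ 4 \<le> \<bar>y\<bar> ^ 2" using True by (intro power_decreasing) auto
    ultimately show ?thesis by simp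
  qed
  ultimately show ?thesis using True by (simp add: min_def)
next
  case False
  then show ?thesis by (simp add: min_def)
qed

lemma abs_one_minus_cos_le_2: "\<bar>1 - cos y\<bar> \<le> 2" for y :: real
  using cos_le_one[of y] cos_ge_minus_one[of y] by linarith

context prob_space
begin

lemma integrable_one_minus_cos:
  fixes \<xi> :: "'a \<Rightarrow> real"
  assumes [measurable]: "\<xi> \<in> borel_measurable M"
  shows "integrable M (\<lambda>\<omega>. 1 - cos (t * \<xi> \<omega>))"
  by (intro integrable_const_bound[where B = 2] AE_I2) (auto simp: abs_one_minus_cos_le_2)

lemma psi_lower_bound:
  fixes \<xi> :: "'a \<Rightarrow> real"
  assumes \<xi> [measurable]: "\<xi> \<in> borel_measurable M" and "b > 0"
  shows "(trunc_moment M \<xi> 2 b / b ^ 2 - tail_fun M \<xi> b) / 4 \<le> psi M \<xi> (1 / b)"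
proof -
  have "(trunc_moment M \<xi> 2 b / b ^ 2 - tail_fun M \<xi> b) / 4 =
      expectation (\<lambda>\<omega>. (min \<bar>\<xi> \<omega>\<bar> b ^ 2 / b ^ 2 - indicator {\<omega>\<in>space M. b \<le> \<bar>\<xi> \<omega>\<bar>} \<omega>) / 4)"
    using integrable_min_power[OF \<xi>, of b 2] \<open>b > 0\<close>
    by (subst integral_divide_zero, subst Bochner_Integration.integral_diff)
      (auto simp: trunc_moment_def tail_fun_def less_top[symmetric]
        intro!: integrable_real_indicator integrable_divide_zero)
  also have "\<dots> \<le> psi M \<xi> (1 / b)"
    unfolding psi_def
  proof (intro integral_mono integrable_one_minus_cos \<xi>)
    show "integrable M (\<lambda>\<omega>. (min \<bar>\<xi> \<omega>\<bar> b ^ 2 / b ^ 2 - indicator {\<omega>\<in>space M. b \<le> \<bar>\<xi> \<omega>\<bar>} \<omega>) / 4)"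
      using integrable_min_power[OF \<xi>, of b 2] \<open>b > 0\<close>
      by (auto simp: less_top[symmetric] intro!: integrable_real_indicator integrable_divide_zero
          Bochner_Integration.integrable_diff)
    fix \<omega> assume "\<omega> \<in> space M"
    have "min \<bar>1 / b * \<xi> \<omega>\<bar> 1 = min \<bar>\<xi> \<omega>\<bar> b / b"
      using \<open>b > 0\<close> by (auto simp: min_def abs_mult field_simps)
    moreover have "\<bar>1 / b * \<xi> \<omega>\<bar> \<ge> 1 \<longleftrightarrow> b \<le> \<bar>\<xi> \<omega>\<bar>"
      using \<open>b > 0\<close> by (auto simp: abs_mult field_simps)
    ultimately show "(min \<bar>\<xi> \<omega>\<bar> b ^ 2 / b ^ 2 - indicator {\<omega>\<in>space M. b \<le> \<bar>\<xi> \<omega>\<bar>} \<omega>) / 4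
        \<le> 1 - cos (1 / b * \<xi> \<omega>)"
      using one_minus_cos_lower_bound[of "1 / b * \<xi> \<omega>"] \<open>\<omega> \<in> space M\<close>
      by (cases "b \<le> \<bar>\<xi> \<omega>\<bar>") (simp_all only: power_divide indicator_def mem_Collect_eq if_True if_False simp_thms of_bool_eq)
  qed
  finally show ?thesis .
qed

lemma continuous_psi:
  fixes \<xi> :: "'a \<Rightarrow> real"
  assumes [measurable]: "\<xi> \<in> borel_measurable M"
  shows "isCont (psi M \<xi>) t"
  unfolding continuous_at_sequentially comp_def psi_def
proof (intro allI impI)
  fix s :: "nat \<Rightarrow> real" assume s: "s \<longlonglongrightarrow> t"
  show "(\<lambda>n. expectation (\<lambda>\<omega>. 1 - cos (s n * \<xi> \<omega>))) \<longlonglongrightarrow> expectation (\<lambda>\<omega>. 1 - cos (t * \<xi> \<omega>))"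
  proof (rule integral_dominated_convergence[where w = "\<lambda>_. 2"])
    show "AE \<omega> in M. (\<lambda>n. 1 - cos (s n * \<xi> \<omega>)) \<longlonglongrightarrow> 1 - cos (t * \<xi> \<omega>)"
      using s by (intro AE_I2 tendsto_intros)
  qed (auto simp: abs_one_minus_cos_le_2)
qed

text \<open>
  \<open>psi\<close> vanishes at 0, so by continuity the values \<open>1 / n\<close> are attained near 0 once they lie
  below a single positive value.
\<close>

lemma norming_equation_solvable:
  fixes \<xi> :: "'a \<Rightarrow> real"
  assumes \<xi>: "\<xi> \<in> borel_measurable M" and "r > 0" "psi M \<xi> r > 0" and "real n * psi M \<xi> r \<ge> 1"
  shows "\<exists>s>0. real n * psi M \<xi> (1 / s) = 1"
proof -
  have n: "real n > 0" using assms(4) by (cases n) auto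
  have "\<exists>t\<ge>0. t \<le> r \<and> psi M \<xi> t = 1 / real n"
  proof (rule IVT)
    show "psi M \<xi> 0 \<le> 1 / real n" by (simp add: psi_def)
    show "1 / real n \<le> psi M \<xi> r" using assms(4) n by (simp add: field_simps)
  qed (use assms continuous_psi in auto)
  then obtain t where t: "0 \<le> t" "psi M \<xi> t = 1 / real n" by auto
  have "t \<noteq> 0" using t n by (auto simp: psi_def)
  then show ?thesis using t n by (intro exI[of _ "1 / t"]) auto
qed

end

section \<open>Laws with a logarithmically perturbed quadratic tail\<close>

lemma exp_less_imp_less_ln:
  fixes a x :: real
  assumes "exp a < x"
  shows "0 < x" "a < ln x"
proof -
  show "0 < x" using assms exp_gt_zero[of a] by linarith
  then show "a < ln x" using assms by (metis exp_less_cancel_iff exp_ln)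
qed

lemma one_plus_powr_le_exp:
  fixes m \<epsilon> :: real
  assumes "m \<ge> 0" "\<epsilon> > 0"
  obtains C where "C \<ge> 1" "\<And>d. d \<ge> 0 \<Longrightarrow> (1 + d) powr m \<le> C * exp (\<epsilon> * d)"
proof -
  define \<delta> where "\<delta> = \<epsilon> / (m + 1)"
  have \<delta>: "\<delta> > 0" "m * \<delta> \<le> \<epsilon>" using assms by (auto simp: \<delta>_def field_simps)
  define c where "c = m * (\<delta> - 1 - ln \<delta>)"
  have "c \<ge> 0" using ln_le_minus_one[OF \<delta>(1)] assms by (auto simp: c_def)
  show thesis
  proof (rule that[of "exp c"])
    fix d :: real assume d: "d \<ge> 0"
    have "ln (\<delta> * (1 + d)) \<le> \<delta> * (1 + d) - 1" using \<delta> d by (intro ln_le_minus_one) simp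
    then have "ln (1 + d) \<le> \<delta> * (1 + d) - 1 - ln \<delta>" using \<delta> d by (simp add: ln_mult)
    then have "m * ln (1 + d) \<le> m * (\<delta> * (1 + d) - 1 - ln \<delta>)" using assms by (intro mult_left_mono)
    also have "\<dots> = c + m * \<delta> * d" by (simp add: c_def algebra_simps)
    also have "\<dots> \<le> c + \<epsilon> * d" using \<delta> d by (simp add: mult_right_mono)
    finally show "(1 + d) powr m \<le> exp c * exp (\<epsilon> * d)"
      using d by (simp add: powr_def exp_add[symmetric])
  qed (use \<open>c \<ge> 0\<close> in auto)
qed

text \<open>
  With \<open>w = ln x\<close> the tail becomes \<open>exp (- 2 * w) * G w\<close>, where \<open>G w = w powr \<gamma> * L w\<close> varies
  regularly with index \<open>\<gamma>\<close>; on this scale all estimates compare values of \<open>G\<close>.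
\<close>

locale log_power_tail = prob_space M for M :: "'a measure" +
  fixes \<xi> :: "'a \<Rightarrow> real" and L :: "real \<Rightarrow> real" and \<gamma> :: real
  assumes \<xi>_meas [measurable]: "\<xi> \<in> borel_measurable M"
    and L_pos: "\<And>y. y > 1 \<Longrightarrow> L y > 0"
    and L_cont: "continuous_on {1<..} L"
    and L_sv: "slowly_varying L"
    and tail_eq: "\<And>x. x > exp 1 \<Longrightarrow> tail_fun M \<xi> x = ln x powr \<gamma> * L (ln x) / x ^ 2"
begin

abbreviation T :: "real \<Rightarrow> real" where "T \<equiv> tail_fun M \<xi>"

definition G :: "real \<Rightarrow> real" where "G w = w powr \<gamma> * L w"

abbreviation K2 :: "real \<Rightarrow> real" where "K2 \<equiv> trunc_moment M \<xi> 2"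

lemma G_pos: "w > 1 \<Longrightarrow> G w > 0"
  using L_pos by (simp add: G_def)

lemma T_eq_G: "x > exp 1 \<Longrightarrow> T x = G (ln x) / x ^ 2"
  by (simp add: tail_eq G_def)

lemma T_antimono: "x \<le> y \<Longrightarrow> T y \<le> T x"
  using tail_fun_antimono[OF \<xi>_meas] .

lemma T_pos: "T x > 0"
proof -
  define y where "y = max x (exp 2)"
  have "exp 1 < y" by (auto simp: y_def less_max_iff_disj)
  then have "T y > 0" using exp_less_imp_less_ln[of 1 y] G_pos[of "ln y"] by (simp add: T_eq_G)
  then show ?thesis using T_antimono[of x y] by (simp add: y_def)
qed

text \<open>
  Nothing is assumed about \<open>L\<close> at 1, but the tail is monotone and lies between 0 and 1, which keeps
  \<open>L\<close> away from 0 and from infinity on every interval \<open>{1<..Y}\<close>.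
\<close>

lemma L_bounded: "\<exists>m>0. \<exists>K. \<forall>y\<in>{1<..Y}. m \<le> L y \<and> L y \<le> K"
proof (cases "Y > 1")
  case True
  have "Y powr - \<bar>\<gamma>\<bar> * T (exp Y) \<le> L y \<and> L y \<le> Y powr \<bar>\<gamma>\<bar> * exp (2 * Y)" if y: "1 < y" "y \<le> Y" for y
  proof -
    have "T (exp y) = y powr \<gamma> * L y / exp y ^ 2" using tail_eq[of "exp y"] y by simp
    then have L: "L y = y powr - \<gamma> * (exp (2 * y) * T (exp y))"
      using y by (simp add: powr_minus field_simps exp_double[symmetric])
    have "y powr - \<gamma> \<le> y powr \<bar>\<gamma>\<bar>" "y powr - \<bar>\<gamma>\<bar> \<le> y powr - \<gamma>" using y by (auto intro!: powr_mono)
    moreover have "y powr \<bar>\<gamma>\<bar> \<le> Y powr \<bar>\<gamma>\<bar>" using y by (intro powr_mono2) auto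
    moreover have "Y powr - \<bar>\<gamma>\<bar> \<le> y powr - \<bar>\<gamma>\<bar>" using y by (intro powr_mono2') auto
    ultimately have p: "Y powr - \<bar>\<gamma>\<bar> \<le> y powr - \<gamma>" "y powr - \<gamma> \<le> Y powr \<bar>\<gamma>\<bar>" by linarith+
    have "T (exp Y) \<le> T (exp y)" using y by (intro T_antimono) auto
    moreover have "1 * T (exp y) \<le> exp (2 * y) * T (exp y)"
      using y by (intro mult_right_mono tail_fun_nonneg) auto
    ultimately have q: "T (exp Y) \<le> exp (2 * y) * T (exp y)" by linarith
    have "exp (2 * y) * T (exp y) \<le> exp (2 * Y) * 1"
      using y by (intro mult_mono tail_fun_le_1 tail_fun_nonneg) auto
    with p q show ?thesis unfolding L
      by (auto intro!: mult_mono simp: tail_fun_nonneg)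
  qed
  moreover have "Y powr - \<bar>\<gamma>\<bar> * T (exp Y) > 0" using True T_pos by simp
  ultimately show ?thesis by (metis greaterThanAtMost_iff)
qed (auto intro: exI[of _ 1])

lemma G_Potter:
  assumes "\<epsilon> > 0"
  obtains A where "A \<ge> 1"
    "\<And>w v. 1 < w \<Longrightarrow> w \<le> v \<Longrightarrow> G v \<le> A * (v / w) powr (\<gamma> + \<epsilon>) * G w"
    "\<And>w v. 1 < w \<Longrightarrow> w \<le> v \<Longrightarrow> G w \<le> A * (v / w) powr (\<epsilon> - \<gamma>) * G v"
proof -
  obtain A where A: "A \<ge> 1"
    "\<And>w v. 1 < w \<Longrightarrow> w \<le> v \<Longrightarrow> L v \<le> A * (v / w) powr \<epsilon> * L w"
    "\<And>w v. 1 < w \<Longrightarrow> w \<le> v \<Longrightarrow> L w \<le> A * (v / w) powr \<epsilon> * L v"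
    using slowly_varying_Potter[OF L_pos L_cont L_sv L_bounded assms] by metis
  show thesis
  proof (rule that[OF A(1)])
    fix w v :: real assume wv: "1 < w" "w \<le> v"
    have v: "v powr \<gamma> = (v / w) powr \<gamma> * w powr \<gamma>"
      using wv by (simp add: powr_divide)
    have w: "w powr \<gamma> = (v / w) powr - \<gamma> * v powr \<gamma>"
      using wv by (simp add: powr_divide powr_minus field_simps)
    have "G v \<le> v powr \<gamma> * (A * (v / w) powr \<epsilon> * L w)"
      unfolding G_def using A(2)[OF wv] by (intro mult_left_mono) auto
    then show "G v \<le> A * (v / w) powr (\<gamma> + \<epsilon>) * G w"
      by (simp add: G_def v powr_add mult_ac)
    have "G w \<le> w powr \<gamma> * (A * (v / w) powr \<epsilon> * L v)"
      unfolding G_def using A(3)[OF wv] by (intro mult_left_mono) auto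
    moreover have "(v / w) powr (\<epsilon> - \<gamma>) = (v / w) powr \<epsilon> * (v / w) powr - \<gamma>"
      by (simp add: powr_add[symmetric])
    ultimately show "G w \<le> A * (v / w) powr (\<epsilon> - \<gamma>) * G v"
      by (simp add: G_def w mult_ac)
  qed
qed

lemma G_doubling:
  obtains A where "A \<ge> 1" "\<And>w v. 1 < w \<Longrightarrow> w \<le> v \<Longrightarrow> v \<le> 2 * w \<Longrightarrow> G v \<le> A * G w"
proof -
  obtain A where A: "A \<ge> 1"
    "\<And>w v. 1 < w \<Longrightarrow> w \<le> v \<Longrightarrow> G v \<le> A * (v / w) powr (\<gamma> + 1) * G w"
    using G_Potter[of 1] by (metis zero_less_one)
  show thesis
  proof (rule that[of "A * 2 powr \<bar>\<gamma> + 1\<bar>"])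
    have "1 * 1 \<le> A * 2 powr \<bar>\<gamma> + 1\<bar>" using A(1) by (intro mult_mono ge_one_powr_ge_zero) auto
    then show "1 \<le> A * 2 powr \<bar>\<gamma> + 1\<bar>" by simp
    fix w v :: real assume wv: "1 < w" "w \<le> v" "v \<le> 2 * w"
    have "(v / w) powr (\<gamma> + 1) \<le> (v / w) powr \<bar>\<gamma> + 1\<bar>" using wv by (intro powr_mono) auto
    also have "\<dots> \<le> 2 powr \<bar>\<gamma> + 1\<bar>" using wv by (intro powr_mono2) (auto simp: field_simps)
    finally have "A * (v / w) powr (\<gamma> + 1) * G w \<le> A * 2 powr \<bar>\<gamma> + 1\<bar> * G w"
      using A(1) G_pos[OF wv(1)] by (intro mult_right_mono mult_left_mono) auto
    with A(2)[OF wv(1,2)] show "G v \<le> A * 2 powr \<bar>\<gamma> + 1\<bar> * G w" by linarith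
  qed
qed

lemma G_exp_bound:
  assumes "\<epsilon> > 0"
  obtains A where "A \<ge> 1"
    "\<And>w v. 1 < w \<Longrightarrow> w \<le> v \<Longrightarrow> G v \<le> A * exp (\<epsilon> * (v - w)) * G w"
    "\<And>w v. 1 < w \<Longrightarrow> w \<le> v \<Longrightarrow> G w \<le> A * exp (\<epsilon> * (v - w)) * G v"
proof -
  obtain A where A: "A \<ge> 1"
    "\<And>w v. 1 < w \<Longrightarrow> w \<le> v \<Longrightarrow> G v \<le> A * (v / w) powr (\<gamma> + 1) * G w"
    "\<And>w v. 1 < w \<Longrightarrow> w \<le> v \<Longrightarrow> G w \<le> A * (v / w) powr (1 - \<gamma>) * G v"
    using G_Potter[of 1] by (metis zero_less_one)
  define m where "m = 1 + \<bar>\<gamma>\<bar>"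
  obtain C where C: "C \<ge> 1" "\<And>d. d \<ge> 0 \<Longrightarrow> (1 + d) powr m \<le> C * exp (\<epsilon> * d)"
    using one_plus_powr_le_exp[of m \<epsilon>] assms unfolding m_def by (metis abs_ge_zero add_nonneg_nonneg zero_le_one)
  have ratio: "A * (v / w) powr a \<le> A * C * exp (\<epsilon> * (v - w))" if wv: "1 < w" "w \<le> v" and "a \<le> m" for w v a
  proof -
    have "v - w \<le> w * (v - w)" using wv mult_right_mono[of 1 w "v - w"] by simp
    then have le: "v / w \<le> 1 + (v - w)" using wv by (simp add: field_simps)
    have "(v / w) powr a \<le> (v / w) powr m" using wv \<open>a \<le> m\<close> by (intro powr_mono) auto
    also have "\<dots> \<le> (1 + (v - w)) powr m"
      using wv le by (intro powr_mono2) (auto simp: m_def)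
    also have "\<dots> \<le> C * exp (\<epsilon> * (v - w))" using wv by (intro C) auto
    finally show ?thesis using A(1) by simp
  qed
  show thesis
  proof (rule that[of "A * C"])
    have "1 * 1 \<le> A * C" using A(1) C(1) by (intro mult_mono) auto
    then show "1 \<le> A * C" by simp
    fix w v :: real assume wv: "1 < w" "w \<le> v"
    show "G v \<le> A * C * exp (\<epsilon> * (v - w)) * G w"
      using A(2)[OF wv] mult_right_mono[OF ratio[OF wv, of "\<gamma> + 1"], of "G w"] G_pos[of w] wv
      by (simp add: m_def) linarith
    show "G w \<le> A * C * exp (\<epsilon> * (v - w)) * G v"
      using A(3)[OF wv] mult_right_mono[OF ratio[OF wv, of "1 - \<gamma>"], of "G v"] G_pos[of v] wv
      by (simp add: m_def) linarith
  qed
qed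

text \<open>
  In terms of \<open>w = ln u\<close> the quantity \<open>u ^ 3 * T u\<close> is \<open>exp w * G w\<close>, and \<open>G\<close> changes more slowly
  than the exponential function.
\<close>

lemma cube_tail_almost_increasing:
  obtains C where "C > 0" "\<And>u z. 0 \<le> u \<Longrightarrow> u \<le> z \<Longrightarrow> exp 1 < z \<Longrightarrow> u ^ 3 * T u \<le> C * (z ^ 3 * T z)"
proof -
  obtain A where A: "A \<ge> 1"
    "\<And>w v. 1 < w \<Longrightarrow> w \<le> v \<Longrightarrow> G w \<le> A * exp (1 * (v - w)) * G v"
    using G_exp_bound[of 1] by (metis zero_less_one)
  have cube: "z ^ 3 * T z = z * G (ln z)" if "exp 1 < z" for z
  proof -
    have "z > 0" using that exp_gt_zero[of 1] by linarith
    then show ?thesis using T_eq_G[OF that] by (simp add: power2_eq_square power3_eq_cube)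
  qed
  have above: "u ^ 3 * T u \<le> A * (z ^ 3 * T z)" if "exp 1 < u" "u \<le> z" for u z
  proof -
    have u: "u > 0" "z > 0" "exp 1 < z" using that exp_gt_zero[of "1::real"] by linarith+
    then have "1 < ln u" "ln u \<le> ln z" using that exp_less_imp_less_ln(2)[of 1 u] by auto
    from A(2)[OF this] have "u * G (ln u) \<le> u * (A * exp (ln z - ln u) * G (ln z))"
      using u by (intro mult_left_mono) auto
    also have "\<dots> = A * (z * G (ln z))" using u by (simp add: exp_diff)
    finally show ?thesis using cube that u by simp
  qed
  \<comment> \<open>Just above \<open>exp 1\<close> monotonicity of the tail gives the lower bound, further out the comparison with \<open>exp 2\<close>.\<close>
  define m where "m = min (T (exp 2)) (exp 2 ^ 3 * T (exp 2) / A)"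
  have m: "m > 0" using T_pos A(1) by (simp add: m_def)
  have m_le: "m \<le> z ^ 3 * T z" if "exp 1 < z" for z
  proof (cases "z \<le> exp 2")
    case True
    have "1 \<le> z" using that by (meson exp_ge_zero le_less_trans less_imp_le one_le_exp_iff order_trans zero_le_one)
    then have "1 * T (exp 2) \<le> z ^ 3 * T z"
      using True by (intro mult_mono T_antimono tail_fun_nonneg) auto
    then show ?thesis by (simp add: m_def)
  next
    case False
    then have "exp 2 ^ 3 * T (exp 2) \<le> A * (z ^ 3 * T z)" by (intro above) auto
    then have "exp 2 ^ 3 * T (exp 2) / A \<le> z ^ 3 * T z" using A(1) by (simp add: field_simps)
    then show ?thesis by (simp add: m_def)
  qed
  show thesis
  proof (rule that[of "A + exp 1 ^ 3 / m"])
    show "A + exp 1 ^ 3 / m > 0" using A m by (simp add: add_pos_pos)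
    fix u z :: real assume uz: "0 \<le> u" "u \<le> z" "exp 1 < z"
    have nonneg: "0 \<le> z ^ 3 * T z" using m m_le[OF uz(3)] by linarith
    show "u ^ 3 * T u \<le> (A + exp 1 ^ 3 / m) * (z ^ 3 * T z)"
    proof (cases "exp 1 < u")
      case True
      have "0 \<le> exp 1 ^ 3 / m * (z ^ 3 * T z)" using m nonneg by simp
      with above[OF True uz(2)] show ?thesis by (simp add: distrib_right)
    next
      case False
      then have "u ^ 3 * T u \<le> exp 1 ^ 3 * 1"
        using uz by (intro mult_mono power_mono tail_fun_le_1 tail_fun_nonneg) auto
      also have "\<dots> = exp 1 ^ 3 / m * m" using m by simp
      also have "\<dots> \<le> exp 1 ^ 3 / m * (z ^ 3 * T z)" using m m_le[OF uz(3)] by (intro mult_left_mono) auto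
      also have "\<dots> \<le> (A + exp 1 ^ 3 / m) * (z ^ 3 * T z)" using A nonneg by (intro mult_right_mono) auto
      finally show ?thesis .
    qed
  qed
qed

lemma fourth_moment_le_tail:
  obtains C where "C > 0" "\<And>z. exp 1 < z \<Longrightarrow> trunc_moment M \<xi> 4 z \<le> C * (z ^ 4 * T z)"
proof -
  obtain C where C: "C > 0"
    "\<And>u z. 0 \<le> u \<Longrightarrow> u \<le> z \<Longrightarrow> exp 1 < z \<Longrightarrow> u ^ 3 * T u \<le> C * (z ^ 3 * T z)"
    using cube_tail_almost_increasing by metis
  show thesis
  proof (rule that[of "4 * C"])
    fix z :: real assume z: "exp 1 < z"
    have "z > 0" using z exp_gt_zero[of 1] by linarith
    have "trunc_moment M \<xi> 4 z - trunc_moment M \<xi> 4 0 \<le> 4 * C * (z ^ 3 * T z) * z - 4 * C * (z ^ 3 * T z) * 0"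
    proof (rule trunc_moment_diff_le[where f = "\<lambda>_. 4 * C * (z ^ 3 * T z)"])
      fix u assume "0 \<le> u" "u \<le> z"
      show "real 4 * u ^ (4 - 1) * T u \<le> 4 * C * (z ^ 3 * T z)"
        using C(2)[OF \<open>0 \<le> u\<close> \<open>u \<le> z\<close> z] by simp
    qed (use \<open>z > 0\<close> in \<open>auto intro!: derivative_eq_intros\<close>)
    moreover have "trunc_moment M \<xi> 4 0 = 0" by (simp add: trunc_moment_def)
    ultimately show "trunc_moment M \<xi> 4 z \<le> 4 * C * (z ^ 4 * T z)"
      by (simp add: eval_nat_numeral mult_ac)
  qed (use C in auto)
qed

text \<open>
  On the range from \<open>sqrt b\<close> to \<open>b\<close> the function \<open>G (ln u)\<close> is at least a constant multiple
  of \<open>G (ln b)\<close>, and \<open>2 * u * T u = 2 * G (ln u) / u\<close> is integrated over it.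
\<close>

lemma G_le_second_moment:
  obtains C where "C > 0" "\<And>b. exp 2 < b \<Longrightarrow> ln b * G (ln b) \<le> C * K2 b"
proof -
  obtain A where A: "A \<ge> 1" "\<And>w v. 1 < w \<Longrightarrow> w \<le> v \<Longrightarrow> v \<le> 2 * w \<Longrightarrow> G v \<le> A * G w"
    using G_doubling by metis
  show thesis
  proof (rule that[of A])
    fix b :: real assume b: "exp 2 < b"
    define l where "l = ln b"
    have l: "l > 2" "b = exp l" using exp_less_imp_less_ln[OF b] by (auto simp: l_def)
    define c where "c = 2 * (G l / A)"
    have "c \<ge> 0" using A(1) G_pos[of l] l by (simp add: c_def)
    have "c * ln (exp l) - c * ln (exp (l / 2)) \<le> K2 (exp l) - K2 (exp (l / 2))"
    proof (rule trunc_moment_diff_ge[where f = "\<lambda>u. c / u" and F = "\<lambda>u. c * ln u"])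
      fix u assume u: "exp (l / 2) \<le> u" "u \<le> exp l"
      have "u > 0" using u(1) exp_gt_zero[of "l / 2"] by linarith
      have w: "l / 2 \<le> ln u" "ln u \<le> l"
        using u \<open>u > 0\<close> ln_ge_iff[of u "l / 2"] ln_le_cancel_iff[of u "exp l"] by auto
      show "((\<lambda>u. c * ln u) has_real_derivative c / u) (at u)"
        using \<open>u > 0\<close> by (auto intro!: derivative_eq_intros)
      show "0 \<le> c / u" using \<open>u > 0\<close> \<open>c \<ge> 0\<close> by simp
      have "exp 1 < u" using u(1) l by (smt (verit) exp_less_cancel_iff field_sum_of_halves)
      then have "real 2 * u ^ (2 - 1) * T u = 2 * G (ln u) / u"
        using \<open>u > 0\<close> by (simp add: T_eq_G power2_eq_square)
      moreover have "c \<le> 2 * G (ln u)"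
        using A(1) A(2)[of "ln u" l] w l by (simp add: c_def field_simps)
      ultimately show "c / u \<le> real 2 * u ^ (2 - 1) * T u"
        using \<open>u > 0\<close> by (simp add: divide_right_mono)
    qed (use l in auto)
    then have "l * (G l / A) \<le> K2 (exp l)"
      using trunc_moment_nonneg[of "exp (l / 2)" \<xi> 2] by (simp add: c_def field_simps)
    then show "ln b * G (ln b) \<le> A * K2 b"
      using A(1) by (simp add: l l_def[symmetric] field_simps)
  qed (use A in auto)
qed

lemma K2_pos: "y > 0 \<Longrightarrow> K2 y > 0"
  using power_times_tail_le_trunc_moment[OF \<xi>_meas, of y 2] T_pos[of y]
  by (smt (verit) mult_pos_pos zero_less_power)

lemma K2_mono: "0 \<le> a \<Longrightarrow> a \<le> y \<Longrightarrow> K2 a \<le> K2 y"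
  by (rule trunc_moment_mono[OF \<xi>_meas])

text \<open>
  The increment from \<open>b\<close> to \<open>x * b\<close> is the integral of \<open>2 * G (ln u) / u\<close>.  On that range \<open>G (ln u)\<close>
  exceeds \<open>G (ln b)\<close> by a factor of order \<open>x powr (1/4)\<close> at most, and the integral of \<open>1 / u\<close> gives
  \<open>ln x\<close>, which is again of that order.  The bound \<open>sqrt x\<close> is far from sharp, but its square divided by
  \<open>x ^ 4\<close> is \<open>1 / x ^ 3\<close>, which is of smaller order than \<open>T x\<close>.
\<close>

lemma K2_growth:
  obtains C where "C > 0" "\<And>b x. exp 2 < b \<Longrightarrow> 1 \<le> x \<Longrightarrow> K2 (x * b) \<le> C * sqrt x * K2 b"
proof -
  obtain A where A: "A \<ge> 1"
    "\<And>w v. 1 < w \<Longrightarrow> w \<le> v \<Longrightarrow> G v \<le> A * exp (1/4 * (v - w)) * G w"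
    using G_exp_bound[of "1/4"] by (metis zero_less_divide_1_iff zero_less_numeral)
  obtain D where D: "D > 0" "\<And>b. exp 2 < b \<Longrightarrow> ln b * G (ln b) \<le> D * K2 b"
    using G_le_second_moment by metis
  show thesis
  proof (rule that[of "1 + 8 * A * D"])
    fix b x :: real assume b: "exp 2 < b" and x: "1 \<le> x"
    have b0: "b > 0" and l: "ln b > 2" using exp_less_imp_less_ln[OF b] by auto
    define q where "q = exp (ln x / 4)"
    have q: "q \<ge> 1" "sqrt x = q * q" "ln x \<le> 4 * q"
    proof -
      show "q \<ge> 1" using x by (simp add: q_def)
      have "x = exp (ln x)" using x by simp
      also have "\<dots> = (q * q) ^ 2" by (simp add: q_def power2_eq_square exp_add[symmetric])
      finally show "sqrt x = q * q" using \<open>q \<ge> 1\<close> by (metis real_sqrt_unique zero_le_mult_iff zero_le_one order_trans)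
      show "ln x \<le> 4 * q" using exp_ge_add_one_self[of "ln x / 4"] unfolding q_def by linarith
    qed
    define c where "c = 2 * (A * q * G (ln b))"
    have c: "c \<ge> 0" using A(1) q(1) G_pos[of "ln b"] l by (simp add: c_def)
    have "K2 (x * b) - K2 b \<le> c * ln (x * b) - c * ln b"
    proof (rule trunc_moment_diff_le[where f = "\<lambda>u. c / u" and F = "\<lambda>u. c * ln u"])
      show "b \<le> x * b" using b0 x by simp
      fix u assume u: "b \<le> u" "u \<le> x * b"
      have "u > 0" using u b0 by linarith
      show "((\<lambda>u. c * ln u) has_real_derivative c / u) (at u)"
        using \<open>u > 0\<close> by (auto intro!: derivative_eq_intros)
      have "exp 1 < u" using u(1) b by (smt (verit) exp_less_cancel_iff)
      then have "real 2 * u ^ (2 - 1) * T u = 2 * G (ln u) / u"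
        using \<open>u > 0\<close> by (simp add: T_eq_G power2_eq_square)
      moreover have "2 * G (ln u) \<le> c"
      proof -
        have w: "ln b \<le> ln u" "ln u \<le> ln x + ln b"
          using u \<open>u > 0\<close> b0 x ln_le_cancel_iff[of u "x * b"] by (auto simp: ln_mult)
        have "G (ln u) \<le> A * exp (1/4 * (ln u - ln b)) * G (ln b)" using w l by (intro A(2)) auto
        also have "\<dots> \<le> A * q * G (ln b)"
          using A(1) G_pos[of "ln b"] l w by (intro mult_right_mono mult_left_mono) (auto simp: q_def)
        finally show ?thesis by (simp add: c_def)
      qed
      ultimately show "real 2 * u ^ (2 - 1) * T u \<le> c / u"
        using \<open>u > 0\<close> by (simp add: divide_right_mono)
    qed (use b0 in auto)
    also have "c * ln (x * b) - c * ln b = c * ln x" using x b0 by (simp add: ln_mult algebra_simps)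
    also have "\<dots> \<le> c * (4 * q)" using q c by (intro mult_left_mono) auto
    also have "\<dots> = 8 * A * sqrt x * G (ln b)" by (simp add: c_def q)
    also have "\<dots> \<le> 8 * A * sqrt x * (D * K2 b)"
    proof (intro mult_left_mono)
      have "1 * G (ln b) \<le> ln b * G (ln b)" using l G_pos[of "ln b"] by (intro mult_right_mono) auto
      then show "G (ln b) \<le> D * K2 b" using D(2)[OF b] by simp
    qed (use A x in auto)
    finally have "K2 (x * b) \<le> K2 b + 8 * A * D * sqrt x * K2 b" by (simp add: mult_ac)
    moreover have "1 * K2 b \<le> sqrt x * K2 b"
      using x b0 K2_pos[of b] by (intro mult_right_mono) auto
    ultimately show "K2 (x * b) \<le> (1 + 8 * A * D) * sqrt x * K2 b" by (simp add: algebra_simps)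
  qed (use A D in \<open>auto intro!: add_pos_pos\<close>)
qed

section \<open>The norming sequence\<close>

text \<open>
  The lower bound for \<open>psi\<close> loses the mass beyond \<open>b\<close>, which is \<open>G (ln b) / b ^ 2\<close>.  For large \<open>b\<close>
  this is a small fraction of \<open>K2 b / b ^ 2\<close>.
\<close>

lemma psi_ge_second_moment:
  obtains B where "B > exp 2" "\<And>b. b \<ge> B \<Longrightarrow> K2 b / (8 * b ^ 2) \<le> psi M \<xi> (1 / b)"
proof -
  obtain C where C: "C > 0" "\<And>b. exp 2 < b \<Longrightarrow> ln b * G (ln b) \<le> C * K2 b"
    using G_le_second_moment by metis
  show thesis
  proof (rule that[of "exp (2 + 2 * C)"])
    fix b :: real assume b: "b \<ge> exp (2 + 2 * C)"
    have "exp 2 < exp (2 + 2 * C)" using C by simp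
    then have b2: "exp 2 < b" using b by linarith
    have b0: "b > 0" using exp_less_imp_less_ln[OF b2] by simp
    then have l: "2 * C \<le> ln b" "1 < ln b" using b C(1) by (auto simp: ln_ge_iff[symmetric])
    have "2 * C * G (ln b) \<le> ln b * G (ln b)" using l G_pos[of "ln b"] by (intro mult_right_mono) auto
    also have "\<dots> \<le> C * K2 b" using C(2)[OF b2] .
    finally have half: "G (ln b) \<le> K2 b / 2" using C(1) by simp
    have "exp 1 < b" using b2 by (smt (verit) exp_less_cancel_iff)
    then have "T b \<le> K2 b / b ^ 2 / 2"
      using half b0 by (simp add: T_eq_G divide_right_mono divide_divide_eq_left mult.commute) (simp add: field_simps)
    then show "K2 b / (8 * b ^ 2) \<le> psi M \<xi> (1 / b)"
      using psi_lower_bound[OF \<xi>_meas b0] by simp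
  qed (use C in auto)
qed

text \<open>
  From some \<open>n\<close> on the norming equation has a solution, so \<open>n * psi (1 / b n) = 1\<close>, and divergence of
  \<open>b\<close> brings \<open>1 / b n\<close> into the range where \<open>psi\<close> is bounded below by the truncated second moment.
\<close>

lemma natural_norming_eventually:
  assumes b: "natural_norming M \<xi> b"
  obtains N where "\<And>n. n \<ge> N \<Longrightarrow> exp 2 < b n" "\<And>n. n \<ge> N \<Longrightarrow> real n * K2 (b n) \<le> 8 * b n ^ 2"
proof -
  obtain B where B: "B > exp 2" "\<And>b. b \<ge> B \<Longrightarrow> K2 b / (8 * b ^ 2) \<le> psi M \<xi> (1 / b)"
    using psi_ge_second_moment by metis
  have B0: "B > 0" using exp_less_imp_less_ln[OF B(1)] by simp
  have "K2 B / (8 * B ^ 2) > 0" using K2_pos[OF B0] B0 by simp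
  then have psi_pos: "psi M \<xi> (1 / B) > 0" using B(2)[of B] by linarith
  have "\<forall>\<^sub>F n in sequentially. b n \<ge> B"
    using b by (auto simp: natural_norming_def filterlim_at_top)
  then obtain N1 where N1: "\<And>n. n \<ge> N1 \<Longrightarrow> b n \<ge> B" by (auto simp: eventually_sequentially)
  obtain N2 :: nat where N2: "1 < real N2 * psi M \<xi> (1 / B)" using reals_Archimedean3[OF psi_pos] by blast
  show thesis
  proof (rule that[of "max 2 (max N1 N2)"])
    fix n assume n: "n \<ge> max 2 (max N1 N2)"
    have bn: "b n \<ge> B" using n N1 by simp
    then show "exp 2 < b n" using B(1) by linarith
    have "real N2 * psi M \<xi> (1 / B) \<le> real n * psi M \<xi> (1 / B)"
      using n psi_pos by (intro mult_right_mono) auto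
    then have "1 \<le> real n * psi M \<xi> (1 / B)" using N2 by linarith
    then have "\<exists>s>0. real n * psi M \<xi> (1 / s) = 1"
      using psi_pos B0 by (intro norming_equation_solvable[OF \<xi>_meas, of "1 / B"]) auto
    then have eq: "real n * psi M \<xi> (1 / b n) = 1"
      using b n by (auto simp: natural_norming_def)
    have "real n * (K2 (b n) / (8 * b n ^ 2)) \<le> real n * psi M \<xi> (1 / b n)"
      using B(2)[OF bn] by (intro mult_left_mono) auto
    then show "real n * K2 (b n) \<le> 8 * b n ^ 2"
      unfolding eq using bn B0 by (simp add: field_simps)
  qed
qed

section \<open>The tail of a large normed sum\<close>

lemma tail_scaling:
  assumes "c > 0"
  obtains C where "C > 0" "\<And>x. exp 1 < x \<Longrightarrow> T (c * x) \<le> C * T x"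
proof -
  obtain C where C: "C > 0"
    "\<And>u z. 0 \<le> u \<Longrightarrow> u \<le> z \<Longrightarrow> exp 1 < z \<Longrightarrow> u ^ 3 * T u \<le> C * (z ^ 3 * T z)"
    using cube_tail_almost_increasing by metis
  show thesis
  proof (rule that[of "max 1 (C / c ^ 3)"])
    fix x :: real assume x: "exp 1 < x"
    have x0: "x > 0" using exp_less_imp_less_ln[OF x] by simp
    show "T (c * x) \<le> max 1 (C / c ^ 3) * T x"
    proof (cases "c \<ge> 1")
      case True
      then have "T (c * x) \<le> 1 * T x" using x0 T_antimono[of x "c * x"] by simp
      also have "\<dots> \<le> max 1 (C / c ^ 3) * T x" using T_pos[of x] by (intro mult_right_mono) auto
      finally show ?thesis .
    next
      case False
      then have "(c * x) ^ 3 * T (c * x) \<le> C * (x ^ 3 * T x)"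
        using assms x0 x by (intro C(2)) auto
      then have "T (c * x) \<le> C / c ^ 3 * T x"
        using assms x0 by (simp add: power_mult_distrib field_simps)
      also have "\<dots> \<le> max 1 (C / c ^ 3) * T x" using T_pos[of x] by (intro mult_right_mono) auto
      finally show ?thesis .
    qed
  qed auto
qed

text \<open>
  The function \<open>u ^ 2 * G u\<close> varies regularly with index \<open>2 + \<gamma> \<ge> 1\<close>, so it even tends to infinity; up to
  \<open>u = 2\<close> the doubling property keeps it away from 0.
\<close>

lemma inverse_square_le_G:
  assumes "\<gamma> \<ge> -1"
  obtains C where "C > 0" "\<And>u. 1 < u \<Longrightarrow> 1 \<le> C * (u ^ 2 * G u)"
proof -
  obtain A where A: "A \<ge> 1"
    "\<And>w v. 1 < w \<Longrightarrow> w \<le> v \<Longrightarrow> G w \<le> A * (v / w) powr (1 - \<gamma>) * G v"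
    using G_Potter[of 1] by (metis zero_less_one)
  obtain D where D: "D \<ge> 1" "\<And>w v. 1 < w \<Longrightarrow> w \<le> v \<Longrightarrow> v \<le> 2 * w \<Longrightarrow> G v \<le> D * G w"
    using G_doubling by metis
  have G2: "G 2 > 0" by (simp add: G_pos)
  show thesis
  proof (rule that[of "(A + D) / G 2"])
    fix u :: real assume u: "1 < u"
    have "G 2 \<le> (A + D) * (u ^ 2 * G u)"
    proof (cases "u \<ge> 2")
      case True
      have "(u / 2) powr (1 - \<gamma>) \<le> (u / 2) powr 2" using True assms by (intro powr_mono) auto
      also have "\<dots> \<le> u ^ 2" using True by (simp add: powr_numeral power_divide field_simps)
      finally have "A * (u / 2) powr (1 - \<gamma>) * G u \<le> A * u ^ 2 * G u"
        using A(1) G_pos[OF u] by (intro mult_right_mono mult_left_mono) auto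
      also have "\<dots> \<le> (A + D) * (u ^ 2 * G u)" using D(1) G_pos[OF u] by (simp add: algebra_simps)
      finally show ?thesis using A(2)[of 2 u] True by simp
    next
      case False
      have "D * G u \<le> D * (u ^ 2 * G u)"
        using D(1) G_pos[OF u] u by (intro mult_left_mono) (auto simp: mult_le_cancel_right1 one_le_power)
      also have "\<dots> \<le> (A + D) * (u ^ 2 * G u)" using A(1) G_pos[OF u] by (intro mult_right_mono) auto
      finally show ?thesis using D(2)[of u 2] u False by simp
    qed
    then show "1 \<le> (A + D) / G 2 * (u ^ 2 * G u)" using G2 by (simp add: field_simps)
  qed (use A D G2 in auto)
qed

text \<open>
  If \<open>l \<le> u\<close>, then \<open>G (u + l)\<close> is comparable with \<open>G u\<close>, and \<open>K2\<close> is bounded below.  If \<open>l > u\<close>, it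
  is comparable with \<open>G l\<close>, which is at most of the order \<open>K2 (exp l) / l\<close>, hence \<open>K2 (exp l) / u\<close>;
  it is here that \<open>\<gamma> \<ge> -1\<close> ensures \<open>1 / u\<close> is of the order \<open>u * G u\<close> at most.
\<close>

lemma G_product_bound:
  assumes "\<gamma> \<ge> -1"
  obtains C where "C > 0"
    "\<And>u b. 1 < u \<Longrightarrow> exp 2 < b \<Longrightarrow> G (u + ln b) \<le> C * K2 b * (u * G u)"
proof -
  obtain A where A: "A \<ge> 1" "\<And>w v. 1 < w \<Longrightarrow> w \<le> v \<Longrightarrow> v \<le> 2 * w \<Longrightarrow> G v \<le> A * G w"
    using G_doubling by metis
  obtain D where D: "D > 0" "\<And>b. exp 2 < b \<Longrightarrow> ln b * G (ln b) \<le> D * K2 b"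
    using G_le_second_moment by metis
  obtain E where E: "E > 0" "\<And>u. 1 < u \<Longrightarrow> 1 \<le> E * (u ^ 2 * G u)"
    using inverse_square_le_G[OF assms] by metis
  have K1: "K2 1 > 0" by (simp add: K2_pos)
  show thesis
  proof (rule that[of "A / K2 1 + A * D * E"])
    show "A / K2 1 + A * D * E > 0" using A D E K1 by (intro add_pos_pos) auto
    fix u b :: real assume u: "1 < u" and b: "exp 2 < b"
    define l where "l = ln b"
    have b0: "b > 0" and l: "l > 2" using exp_less_imp_less_ln[OF b] by (auto simp: l_def)
    have "1 < exp (2::real)" by simp
    then have b1: "b > 1" using b by linarith
    have Gu: "G u > 0" using G_pos u .
    have Kb: "K2 b > 0" by (rule K2_pos[OF b0])
    show "G (u + ln b) \<le> (A / K2 1 + A * D * E) * K2 b * (u * G u)"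
    proof (cases "l \<le> u")
      case True
      have "K2 1 * 1 \<le> K2 b * u" using K2_mono[of 1 b] b1 u Kb by (intro mult_mono) auto
      then have "1 \<le> K2 b * u / K2 1" using K1 by simp
      then have "A * G u * 1 \<le> A * G u * (K2 b * u / K2 1)"
        using A(1) Gu by (intro mult_left_mono) auto
      also have "\<dots> \<le> (A / K2 1 + A * D * E) * K2 b * (u * G u)"
        using A(1) D(1) E(1) Gu Kb u by (simp add: algebra_simps)
      finally show ?thesis using A(2)[of u "u + l"] True u l by (simp add: l_def)
    next
      case False
      have "u * G l \<le> l * G l" using False G_pos[of l] l by (intro mult_right_mono) auto
      also have "\<dots> \<le> D * K2 b" using D(2)[OF b] by (simp add: l_def)
      finally have "G l \<le> D * K2 b / u" using u by (simp add: field_simps)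
      also have "\<dots> = D * K2 b / u * 1" by simp
      also have "\<dots> \<le> D * K2 b / u * (E * (u ^ 2 * G u))"
        using D(1) Kb u E(2)[OF u] by (intro mult_left_mono) auto
      also have "\<dots> = D * E * K2 b * (u * G u)" using u by (simp add: power2_eq_square)
      finally have "A * G l \<le> A * (D * E * K2 b * (u * G u))" using A(1) by (intro mult_left_mono) auto
      also have "\<dots> \<le> (A / K2 1 + A * D * E) * K2 b * (u * G u)"
        using A(1) K1 Gu Kb u by (simp add: algebra_simps)
      finally show ?thesis using A(2)[of l "u + l"] False u l by (simp add: l_def)
    qed
  qed
qed

text \<open>
  The three contributions at level \<open>z = x * b\<close>.  A single large summand costs \<open>n * T z\<close>, which the
  product bound handles.  The fourth moment costs no more, as it is of the order \<open>z ^ 4 * T z\<close>.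
  The squared second moment gives \<open>(K2 z / K2 b) ^ 2 / x ^ 4\<close>, at most of the order \<open>1 / x ^ 3\<close>, whereas
  \<open>x ^ 3 * T x\<close> is bounded below.
\<close>

lemma large_n_bound:
  assumes "\<gamma> \<ge> -1"
  obtains C where "C > 0"
    "\<And>x b n. exp 1 < x \<Longrightarrow> exp 2 < b \<Longrightarrow> real n * K2 b \<le> 8 * b ^ 2 \<Longrightarrow>
      real n * T (x * b) + (real n * trunc_moment M \<xi> 4 (x * b) + 3 * (real n * K2 (x * b)) ^ 2) / (x * b) ^ 4
        \<le> C * (T x * ln x)"
proof -
  obtain P where P: "P > 0"
    "\<And>u b. 1 < u \<Longrightarrow> exp 2 < b \<Longrightarrow> G (u + ln b) \<le> P * K2 b * (u * G u)"
    using G_product_bound[OF assms] by metis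
  obtain Q where Q: "Q > 0" "\<And>z. exp 1 < z \<Longrightarrow> trunc_moment M \<xi> 4 z \<le> Q * (z ^ 4 * T z)"
    using fourth_moment_le_tail by metis
  obtain R where R: "R > 0" "\<And>b x. exp 2 < b \<Longrightarrow> 1 \<le> x \<Longrightarrow> K2 (x * b) \<le> R * sqrt x * K2 b"
    using K2_growth by metis
  obtain S where S: "S > 0"
    "\<And>u z. 0 \<le> u \<Longrightarrow> u \<le> z \<Longrightarrow> exp 1 < z \<Longrightarrow> u ^ 3 * T u \<le> S * (z ^ 3 * T z)"
    using cube_tail_almost_increasing by metis
  have T1: "T 1 > 0" by (rule T_pos)
  show thesis
  proof (rule that[of "(1 + Q) * (8 * P) + 192 * R ^ 2 * S / T 1"])
    show "(1 + Q) * (8 * P) + 192 * R ^ 2 * S / T 1 > 0" using P Q R S T1 by (intro add_pos_pos) auto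
    fix x b :: real and n :: nat
    assume x: "exp 1 < x" and b: "exp 2 < b" and nK: "real n * K2 b \<le> 8 * b ^ 2"
    have x0: "x > 0" and u: "ln x > 1" using exp_less_imp_less_ln[OF x] by auto
    have x1: "x > 1" using u x0 by (smt (verit) ln_le_zero_iff)
    have b0: "b > 0" and l: "ln b > 2" using exp_less_imp_less_ln[OF b] by auto
    have "1 < exp (2::real)" by simp
    then have b1: "b > 1" using b by linarith
    have Kb: "K2 b > 0" by (rule K2_pos[OF b0])
    have "x * 1 < x * b" using x0 b1 by (intro mult_strict_left_mono) auto
    then have z: "exp 1 < x * b" using x by linarith
    have n_le: "real n \<le> 8 * b ^ 2 / K2 b" using nK Kb by (simp add: field_simps)

    have jump: "real n * T (x * b) \<le> 8 * P * (T x * ln x)"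
    proof -
      have "real n * T (x * b) \<le> 8 * b ^ 2 / K2 b * T (x * b)"
        using n_le by (intro mult_right_mono tail_fun_nonneg)
      also have "\<dots> = 8 * G (ln x + ln b) / (K2 b * x ^ 2)"
        using b0 x0 Kb T_eq_G[OF z] by (simp add: ln_mult power_mult_distrib)
      also have "\<dots> \<le> 8 * (P * K2 b * (ln x * G (ln x))) / (K2 b * x ^ 2)"
        using P(2)[OF u b] Kb by (intro divide_right_mono) auto
      also have "\<dots> = 8 * P * (T x * ln x)"
        using Kb T_eq_G[OF x] by (simp add: field_simps)
      finally show ?thesis .
    qed
    have fourth: "real n * trunc_moment M \<xi> 4 (x * b) / (x * b) ^ 4 \<le> Q * (real n * T (x * b))"
    proof -
      have "real n * trunc_moment M \<xi> 4 (x * b) / (x * b) ^ 4 \<le> real n * (Q * ((x * b) ^ 4 * T (x * b))) / (x * b) ^ 4"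
        using Q(2)[OF z] by (intro divide_right_mono mult_left_mono) auto
      also have "\<dots> = Q * (real n * T (x * b))" using x0 b0 by simp
      finally show ?thesis .
    qed
    have second: "3 * (real n * K2 (x * b)) ^ 2 / (x * b) ^ 4 \<le> 192 * R ^ 2 * S / T 1 * (T x * ln x)"
    proof -
      have "real n * K2 (x * b) \<le> real n * (R * sqrt x * K2 b)"
        using R(2)[OF b] x1 by (intro mult_left_mono) auto
      also have "\<dots> = R * sqrt x * (real n * K2 b)" by simp
      also have "\<dots> \<le> R * sqrt x * (8 * b ^ 2)" using nK R(1) x0 by (intro mult_left_mono) auto
      finally have "(real n * K2 (x * b)) ^ 2 \<le> (R * sqrt x * (8 * b ^ 2)) ^ 2"
        using K2_pos[of "x * b"] x0 b0 by (intro power_mono) auto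
      also have "\<dots> = 64 * R ^ 2 * x * b ^ 4" using x0 by (simp add: power_mult_distrib)
      finally have "3 * (real n * K2 (x * b)) ^ 2 / (x * b) ^ 4 \<le> 3 * (64 * R ^ 2 * x * b ^ 4) / (x * b) ^ 4"
        by (intro divide_right_mono mult_left_mono) auto
      also have "\<dots> = 192 * R ^ 2 * (1 / x ^ 3)"
        using x0 b0 by (simp add: power_mult_distrib eval_nat_numeral)
      also have "\<dots> \<le> 192 * R ^ 2 * (S / T 1 * (T x * ln x))"
      proof (intro mult_left_mono)
        have "1 / x ^ 3 \<le> S / T 1 * T x"
          using S(2)[of 1 x] x x1 T1 by (simp add: field_simps)
        also have "\<dots> = S / T 1 * (T x * 1)" by simp
        also have "\<dots> \<le> S / T 1 * (T x * ln x)"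
          using u S(1) T1 T_pos[of x] by (intro mult_left_mono) auto
        finally show "1 / x ^ 3 \<le> S / T 1 * (T x * ln x)" .
      qed auto
      finally show ?thesis by simp
    qed
    have "Q * (real n * T (x * b)) \<le> Q * (8 * P * (T x * ln x))"
      using jump Q(1) by (intro mult_left_mono) auto
    then show "real n * T (x * b) + (real n * trunc_moment M \<xi> 4 (x * b) + 3 * (real n * K2 (x * b)) ^ 2) / (x * b) ^ 4
        \<le> ((1 + Q) * (8 * P) + 192 * R ^ 2 * S / T 1) * (T x * ln x)"
      using jump fourth second by (simp add: add_divide_distrib algebra_simps)
  qed
qed

text \<open>
  The integrand \<open>2 * G (ln u) / u\<close> is at most of the order \<open>ln u powr (- \<delta> - 1) / u\<close> with \<open>\<delta>\<close> halfway between
  0 and \<open>- \<gamma> - 1\<close>, and this is integrable at infinity: the variance is finite.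
\<close>

lemma K2_bounded:
  assumes "\<gamma> < -1"
  obtains C where "C > 0" "\<And>y. 0 \<le> y \<Longrightarrow> K2 y \<le> C"
proof -
  define \<delta> where "\<delta> = - (\<gamma> + 1) / 2"
  have \<delta>: "\<delta> > 0" "\<gamma> + \<delta> = - \<delta> - 1" using assms by (auto simp: \<delta>_def field_simps)
  obtain A where A: "A \<ge> 1"
    "\<And>w v. 1 < w \<Longrightarrow> w \<le> v \<Longrightarrow> G v \<le> A * (v / w) powr (\<gamma> + \<delta>) * G w"
    using G_Potter[OF \<delta>(1)] by metis
  define c where "c = 2 * A * G 2"
  have c: "c > 0" using A(1) G_pos[of 2] by (simp add: c_def)
  define F where "F = (\<lambda>u. - (2 * c / \<delta>) * (ln u / 2) powr - \<delta>)"
  have incr: "K2 y - K2 (exp 2) \<le> 2 * c / \<delta>" if y: "exp 2 \<le> y" for y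
  proof -
    have "K2 y - K2 (exp 2) \<le> F y - F (exp 2)"
    proof (rule trunc_moment_diff_le[where f = "\<lambda>u. c * (ln u / 2) powr (- \<delta> - 1) / u"])
      fix u :: real assume u: "exp 2 \<le> u" "u \<le> y"
      have u0: "u > 0" using u(1) exp_gt_zero[of 2] by linarith
      then have lu: "ln u \<ge> 2" using u by (simp add: ln_ge_iff)
      have "u > 1" using lu u0 by (smt (verit) ln_le_zero_iff)
      show "(F has_real_derivative c * (ln u / 2) powr (- \<delta> - 1) / u) (at u)"
        unfolding F_def using \<open>u > 1\<close> lu \<delta>(1)
        by (auto intro!: derivative_eq_intros simp: field_simps)
      have "exp 1 < u" using u(1) by (smt (verit) exp_less_cancel_iff)
      then have "real 2 * u ^ (2 - 1) * T u = 2 * G (ln u) / u"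
        using u0 by (simp add: T_eq_G power2_eq_square)
      also have "\<dots> \<le> c * (ln u / 2) powr (- \<delta> - 1) / u"
        using A(2)[of 2 "ln u"] lu u0 by (intro divide_right_mono) (auto simp: c_def \<delta>(2) mult_ac)
      finally show "real 2 * u ^ (2 - 1) * T u \<le> c * (ln u / 2) powr (- \<delta> - 1) / u" .
    qed (use y in auto)
    also have "\<dots> \<le> 2 * c / \<delta>" using c \<delta>(1) by (simp add: F_def)
    finally show ?thesis .
  qed
  show thesis
  proof (rule that[of "K2 (exp 2) + 2 * c / \<delta>"])
    show "K2 (exp 2) + 2 * c / \<delta> > 0" using K2_pos[of "exp 2"] c \<delta>(1) by (intro add_pos_pos) auto
    fix y :: real assume "0 \<le> y"
    then have "K2 y \<le> K2 (max y (exp 2))" by (intro K2_mono) auto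
    with incr[of "max y (exp 2)"] show "K2 y \<le> K2 (exp 2) + 2 * c / \<delta>" by simp
  qed
qed

section \<open>The supremum over all sample sizes\<close>

context
  fixes X :: "nat \<Rightarrow> 'a \<Rightarrow> real" and b :: "nat \<Rightarrow> real"
  assumes sym: "symmetric_rv M \<xi>"
    and copies: "independent_copies M \<xi> X"
    and norming: "natural_norming M \<xi> b"
begin

lemma copy_meas: "k \<in> {1..n} \<Longrightarrow> X k \<in> borel_measurable M"
  using copies by (auto simp: independent_copies_def indep_vars_def)

lemma b_pos: "n \<ge> 1 \<Longrightarrow> b n > 0"
  using norming by (auto simp: natural_norming_def)

lemma tail_normed_sum: "n \<ge> 1 \<Longrightarrow>
    tail_fun M (normed_sum X b n) x = tail_fun M (\<lambda>\<omega>. \<Sum>k\<in>{1..n}. X k \<omega>) (x * b n)"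
  using b_pos[of n] by (simp add: tail_fun_def normed_sum_def abs_div field_simps)

lemma uniform_tail_leI:
  "(\<And>n. n \<ge> 1 \<Longrightarrow> tail_fun M (normed_sum X b n) x \<le> c) \<Longrightarrow> uniform_tail M X b x \<le> c"
  unfolding uniform_tail_def by (intro cSUP_least) auto

lemma indep_sum: "indep_vars (\<lambda>_. borel) X {1..n}"
  using copies indep_vars_subset[of "\<lambda>_. borel" X "{1..}" "{1..n}"]
  by (auto simp: independent_copies_def)

lemma distr_copy: "k \<in> {1..n} \<Longrightarrow> distr M borel (X k) = distr M borel \<xi>"
  using copies by (auto simp: independent_copies_def)

text \<open>
  Only finitely many \<open>n\<close> escape the moment bound, among them all those for which \<open>b n\<close> is arbitrary;
  for each of them the sum has a tail comparable with \<open>T\<close>, and \<open>ln x > 1\<close>.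
\<close>

lemma uniform_tail_le_tail_times_ln:
  assumes "\<gamma> \<ge> -1"
  obtains C where "C > 0" "\<And>x. exp 1 < x \<Longrightarrow> uniform_tail M X b x \<le> C * (T x * ln x)"
proof -
  obtain C where C: "C > 0"
    "\<And>x b n. exp 1 < x \<Longrightarrow> exp 2 < b \<Longrightarrow> real n * K2 b \<le> 8 * b ^ 2 \<Longrightarrow>
      real n * T (x * b) + (real n * trunc_moment M \<xi> 4 (x * b) + 3 * (real n * K2 (x * b)) ^ 2) / (x * b) ^ 4
        \<le> C * (T x * ln x)"
    using large_n_bound[OF assms] by metis
  obtain N where N: "\<And>n. n \<ge> N \<Longrightarrow> exp 2 < b n" "\<And>n. n \<ge> N \<Longrightarrow> real n * K2 (b n) \<le> 8 * b n ^ 2"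
    using natural_norming_eventually[OF norming] by metis
  have "\<forall>n\<in>{1..}. \<exists>c>0. \<forall>x>exp 1. T (b n / real n * x) \<le> c * T x"
  proof
    fix n :: nat assume "n \<in> {1..}"
    then have "b n / real n > 0" using b_pos[of n] by simp
    then show "\<exists>c>0. \<forall>x>exp 1. T (b n / real n * x) \<le> c * T x" using tail_scaling by metis
  qed
  then obtain c where c: "\<And>n. n \<ge> 1 \<Longrightarrow> c n > 0"
    "\<And>n x. n \<ge> 1 \<Longrightarrow> exp 1 < x \<Longrightarrow> T (b n / real n * x) \<le> c n * T x"
    using bchoice[of "{1::nat..}"] by (metis atLeast_iff)
  define D where "D = C + (\<Sum>n=1..N. real n * c n)"
  have c_nonneg: "0 \<le> real n * c n" if "n \<ge> 1" for n using c(1)[OF that] by simp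
  have D: "D \<ge> C" "\<And>n. n \<ge> 1 \<Longrightarrow> n \<le> N \<Longrightarrow> real n * c n \<le> D"
  proof -
    show "D \<ge> C" unfolding D_def using c_nonneg by (auto intro!: sum_nonneg)
    fix n assume "n \<ge> 1" "n \<le> N"
    then have "real n * c n \<le> (\<Sum>n=1..N. real n * c n)" using c_nonneg by (intro member_le_sum) auto
    then show "real n * c n \<le> D" using C(1) by (simp add: D_def)
  qed
  show thesis
  proof (rule that[of D])
    show "D > 0" using C(1) D(1) by linarith
    fix x :: real assume x: "exp 1 < x"
    have x0: "x > 0" and u: "ln x > 1" using exp_less_imp_less_ln[OF x] by auto
    show "uniform_tail M X b x \<le> D * (T x * ln x)"
    proof (rule uniform_tail_leI)
      fix n :: nat assume n: "n \<ge> 1"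
      have z: "x * b n > 0" using x0 b_pos[OF n] by simp
      have Tln: "T x * 1 \<le> T x * ln x" using u T_pos[of x] by (intro mult_left_mono) auto
      show "tail_fun M (normed_sum X b n) x \<le> D * (T x * ln x)"
      proof (cases "n \<le> N")
        case True
        have "tail_fun M (normed_sum X b n) x \<le> real n * T (x * b n / real n)"
          using tail_sum_le_max[where I = "{1..n}" and X = X,
              OF \<xi>_meas _ copy_meas[of _ n] distr_copy[of _ n] z] tail_normed_sum[OF n] by simp
        also have "\<dots> \<le> real n * (c n * T x)"
          using c(2)[OF n x] by (intro mult_left_mono) (auto simp: mult.commute)
        also have "\<dots> = real n * c n * T x" by simp
        also have "\<dots> \<le> D * T x" using D(2)[OF n True] T_pos[of x] by (intro mult_right_mono) auto
        also have "\<dots> \<le> D * (T x * ln x)" using Tln C(1) D(1) by (intro mult_left_mono) auto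
        finally show ?thesis .
      next
        case False
        have "tail_fun M (normed_sum X b n) x \<le> real n * T (x * b n) +
            (real n * trunc_moment M \<xi> 4 (x * b n) + 3 * (real n * K2 (x * b n)) ^ 2) / (x * b n) ^ 4"
          using tail_sum_le_fourth_moment[where I = "{1..n}" and X = X,
              OF \<xi>_meas sym _ indep_sum distr_copy[of _ n] z] tail_normed_sum[OF n]
          by simp
        also have "\<dots> \<le> C * (T x * ln x)" using False N x by (intro C(2)) auto
        also have "\<dots> \<le> D * (T x * ln x)" using D(1) u T_pos[of x] by (intro mult_right_mono) auto
        finally show ?thesis .
      qed
    qed
  qed
qed

text \<open>
  With \<open>K2\<close> bounded, this is Chebyshev's inequality, once \<open>n / b n ^ 2\<close> is known to be bounded: for
  large \<open>n\<close> because of \<open>n * K2 (b n) \<le> 8 * b n ^ 2\<close>, and the other \<open>n\<close> are finite in number.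
\<close>

lemma uniform_tail_le_inverse_square:
  assumes "\<gamma> < -1"
  obtains C where "C > 0" "\<And>x. 0 < x \<Longrightarrow> uniform_tail M X b x \<le> C / x ^ 2"
proof -
  obtain K where K: "K > 0" "\<And>y. 0 \<le> y \<Longrightarrow> K2 y \<le> K" using K2_bounded[OF assms] by metis
  obtain N where N: "\<And>n. n \<ge> N \<Longrightarrow> exp 2 < b n" "\<And>n. n \<ge> N \<Longrightarrow> real n * K2 (b n) \<le> 8 * b n ^ 2"
    using natural_norming_eventually[OF norming] by metis
  have K1: "K2 1 > 0" by (simp add: K2_pos)
  define D where "D = 8 / K2 1 + (\<Sum>n=1..N. real n / b n ^ 2)"
  have D0: "D > 0" unfolding D_def using K1 by (intro add_pos_nonneg sum_nonneg) auto
  have D: "real n / b n ^ 2 \<le> D" if n: "n \<ge> 1" for n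
  proof (cases "n \<le> N")
    case True
    then have "real n / b n ^ 2 \<le> (\<Sum>n=1..N. real n / b n ^ 2)" using n by (intro member_le_sum) auto
    then show ?thesis using K1 by (simp add: D_def add_increasing)
  next
    case False
    then have big: "exp 2 < b n" and eq: "real n * K2 (b n) \<le> 8 * b n ^ 2" using N by auto
    have "1 < exp (2::real)" by simp
    then have "1 \<le> b n" using big by linarith
    then have "real n * K2 1 \<le> real n * K2 (b n)" by (intro mult_left_mono K2_mono) auto
    then have "real n / b n ^ 2 \<le> 8 / K2 1" using eq K1 b_pos[OF n] by (simp add: field_simps)
    moreover have "0 \<le> (\<Sum>n=1..N. real n / b n ^ 2)" by (intro sum_nonneg) auto
    ultimately show ?thesis by (simp add: D_def)
  qed
  show thesis
  proof (rule that[of "2 * K * D"])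
    show "2 * K * D > 0" using K D0 by simp
    fix x :: real assume x: "0 < x"
    show "uniform_tail M X b x \<le> 2 * K * D / x ^ 2"
    proof (rule uniform_tail_leI)
      fix n :: nat assume n: "n \<ge> 1"
      have z: "x * b n > 0" using x b_pos[OF n] by simp
      have "T (x * b n) \<le> K2 (x * b n) / (x * b n) ^ 2"
        using power_times_tail_le_trunc_moment[OF \<xi>_meas, of "x * b n" 2] z zero_less_power[OF z, of 2]
        by (simp add: pos_le_divide_eq mult.commute)
      then have "real n * T (x * b n) \<le> real n * (K2 (x * b n) / (x * b n) ^ 2)"
        by (intro mult_left_mono) auto
      moreover have "tail_fun M (normed_sum X b n) x \<le>
          real n * T (x * b n) + real n * K2 (x * b n) / (x * b n) ^ 2"
        using tail_sum_le_second_moment[where I = "{1..n}" and X = X,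
              OF \<xi>_meas sym _ indep_sum distr_copy[of _ n] z] tail_normed_sum[OF n]
        by simp
      ultimately have "tail_fun M (normed_sum X b n) x \<le>
          real n * K2 (x * b n) / (x * b n) ^ 2 + real n * K2 (x * b n) / (x * b n) ^ 2"
        by (simp only: times_divide_eq_right)
      also have "\<dots> \<le> real n * K / (x * b n) ^ 2 + real n * K / (x * b n) ^ 2"
        using K(2)[of "x * b n"] z by (intro add_mono mult_left_mono divide_right_mono) auto
      also have "\<dots> = 2 * K * (real n / b n ^ 2) / x ^ 2" by (simp add: power_mult_distrib field_simps)
      also have "\<dots> \<le> 2 * K * D / x ^ 2"
        using D[OF n] K(1) by (intro divide_right_mono mult_left_mono) auto
      finally show "tail_fun M (normed_sum X b n) x \<le> 2 * K * D / x ^ 2" .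
    qed
  qed
qed

end

end

theorem theorem3p1:
  fixes M :: "'a measure" and \<xi> :: "'a \<Rightarrow> real" and X :: "nat \<Rightarrow> 'a \<Rightarrow> real"
    and b :: "nat \<Rightarrow> real" and L :: "real \<Rightarrow> real" and \<gamma> :: real
  assumes "prob_space M"
    and "\<xi> \<in> borel_measurable M"
    and "symmetric_rv M \<xi>"
    and "\<And>y. y > 1 \<Longrightarrow> L y > 0"
    and "continuous_on {1<..} L"
    and "slowly_varying L"
    and "\<And>x. x > exp 1 \<Longrightarrow> tail_fun M \<xi> x = ln x powr \<gamma> * L (ln x) / x ^ 2"
    and "independent_copies M \<xi> X"
    and "natural_norming M \<xi> b"
  shows "(\<gamma> \<ge> -1 \<longrightarrow>
           (\<exists>C>0. \<forall>x>exp 1.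
              uniform_tail M X b x \<le> C * (ln x powr (\<gamma> + 1) * L (ln x) / x ^ 2) \<and>
              C * (ln x powr (\<gamma> + 1) * L (ln x) / x ^ 2) = C * tail_fun M \<xi> x * ln x)) \<and>
         (\<gamma> < -1 \<longrightarrow>
           (\<exists>C>0. \<forall>x>1. uniform_tail M X b x \<le> C / x ^ 2))"
proof -
  interpret prob_space M by fact
  interpret log_power_tail M \<xi> L \<gamma> by unfold_locales (use assms in auto)
  have eq: "ln x powr (\<gamma> + 1) * L (ln x) / x ^ 2 = tail_fun M \<xi> x * ln x" if "exp 1 < x" for x
  proof -
    have "1 < x" using exp_less_imp_less_ln[OF that] by (smt (verit) ln_le_zero_iff)
    then show ?thesis using tail_eq[OF that] by (simp add: powr_add)
  qed
  show ?thesis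
  proof (intro conjI impI)
    assume "\<gamma> \<ge> -1"
    then obtain C where "C > 0" "\<And>x. exp 1 < x \<Longrightarrow> uniform_tail M X b x \<le> C * (tail_fun M \<xi> x * ln x)"
      using uniform_tail_le_tail_times_ln[OF assms(3,8,9)] by metis
    then show "\<exists>C>0. \<forall>x>exp 1.
        uniform_tail M X b x \<le> C * (ln x powr (\<gamma> + 1) * L (ln x) / x ^ 2) \<and>
        C * (ln x powr (\<gamma> + 1) * L (ln x) / x ^ 2) = C * tail_fun M \<xi> x * ln x"
      by (intro exI[of _ C]) (simp add: eq)
  next
    assume "\<gamma> < -1"
    then obtain C where "C > 0" "\<And>x. 0 < x \<Longrightarrow> uniform_tail M X b x \<le> C / x ^ 2"
      using uniform_tail_le_inverse_square[OF assms(3,8,9)] by metis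
    then show "\<exists>C>0. \<forall>x>1. uniform_tail M X b x \<le> C / x ^ 2"
      by (intro exI[of _ C]) auto
  qed
qed

end
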